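(* Let $d\in\{2,3,\ldots\}$ and $R>0$. There exists precisely one $C^\infty$-function $$H:(\mathbf{H}_R^d\times\mathbf{H}_R^d)\setminus\{(\mathbf{x},\mathbf{x}):\mathbf{x}\in\mathbf{H}_R^d\}\to\mathbb{R}$$ such that for all $\mathbf{x}'\in\mathbf{H}_R^d$ the function $H_{\mathbf{x}'}:\mathbf{H}_R^d\setminus\{\mathbf{x}'\}\to\mathbb{R}$ defined by $H_{\mathbf{x}'}(\mathbf{x}):=H(\mathbf{x},\mathbf{x}')$ is a distribution on $\mathbf{H}_R^d$ with $$-\Delta H_{\mathbf{x}'}=\delta_g(\cdot,\mathbf{x}')$$ and $$\lim_{\mathrm{dist}(\mathbf{x},\mathbf{x}')\to\infty}H_{\mathbf{x}'}(\mathbf{x})=0,$$ where $\mathrm{dist}(\mathbf{x},\mathbf{x}')$ is the geodesic distance between $\mathbf{x},\mathbf{x}'\in\mathbf{H}_R^d$ and $\Delta$ is the Laplace-Beltrami operator on $\mathbf{H}_R^d$.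
   Context: Minkowski bilinear form on $\mathbb{R}^{d+1}$ with coordinates $(x_0,x_1,\ldots,x_d)$: $[\mathbf{x},\mathbf{y}]=x_0y_0-x_1y_1-\cdots-x_dy_d$. For $R>0$, the $R$-radius hyperboloid $\mathbf{H}_R^d$ is the upper sheet $\{\mathbf{x}\in\mathbb{R}^{d+1}:[\mathbf{x},\mathbf{x}]=R^2,\ x_0>0\}$, with the Riemannian metric $g$ obtained by restricting $-[\cdot,\cdot]$ to tangent spaces; it has constant sectional curvature $-1/R^2$. In geodesic polar coordinates $\mathbf{x}=(R\cosh r,\,R\sinh r\,\omega)$ with $r\ge 0$, $\omega\in\mathbf{S}^{d-1}$, the metric is $ds^2=R^2(dr^2+\sinh^2 r\,d\omega^2)$ where $d\omega^2$ is the round metric on the unit sphere $\mathbf{S}^{d-1}$, the Riemannian volume measure is $d\mathrm{vol}_g=R^d\sinh^{d-1}r\,dr\,d\omega$, and the Laplace-Beltrami operator is $$\Delta f=\frac{1}{R^2}\left[\frac{\partial^2 f}{\partial r^2}+(d-1)\coth r\frac{\partial f}{\partial r}+\frac{1}{\sinh^2 r}\Delta_{\mathbf{S}^{d-1}}f\right].$$ The geodesic distance on $\mathbf{H}_R^d$ is $\mathrm{dist}(\mathbf{x},\mathbf{x}')=R\cosh^{-1}\left([\mathbf{x},\mathbf{x}']/R^2\right)$. $\delta_g(\cdot,\mathbf{x}')$ is the Dirac delta at $\mathbf{x}'$ with respect to $d\mathrm{vol}_g$. That the function $H_{\mathbf{x}'}$ "is a distribution on $\mathbf{H}_R^d$"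 means that it is locally integrable on $\mathbf{H}_R^d$ (with respect to $d\mathrm{vol}_g$) and is identified with the distribution $\varphi\mapsto\int H_{\mathbf{x}'}\varphi\,d\mathrm{vol}_g$; the equation $-\Delta H_{\mathbf{x}'}=\delta_g(\cdot,\mathbf{x}')$ then means $\int_{\mathbf{H}_R^d}H_{\mathbf{x}'}(\mathbf{x})\,(-\Delta\varphi)(\mathbf{x})\,d\mathrm{vol}_g(\mathbf{x})=\varphi(\mathbf{x}')$ for all $\varphi\in C_c^\infty(\mathbf{H}_R^d)$. The limit condition means that for each fixed $\mathbf{x}'$ and each $\varepsilon>0$ there is $M>0$ such that $|H_{\mathbf{x}'}(\mathbf{x})|<\varepsilon$ whenever $\mathrm{dist}(\mathbf{x},\mathbf{x}')>M$. *)

theory Defs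
  imports "HOL-Analysis.Analysis"
begin

text \<open>
  A point \<open>(x\<^sub>0, x\<^sub>1, \<dots>, x\<^sub>d)\<close> of \<open>(d+1)\<close>-dimensional space is a pair in
  \<^typ>\<open>real \<times> (real ^ 'n)\<close> with \<open>d = CARD('n)\<close>; the first component is the time coordinate.
\<close>

definition minkowski :: "real \<times> (real ^ 'n) \<Rightarrow> real \<times> (real ^ 'n) \<Rightarrow> real" where
  "minkowski x y = fst x * fst y - (\<Sum>i\<in>UNIV. snd x $ i * snd y $ i)"

definition hyperboloid :: "real \<Rightarrow> (real \<times> (real ^ 'n)) set" where
  "hyperboloid R = {x. minkowski x x = R\<^sup>2 \<and> fst x > 0}"

definition geodesic_dist :: "real \<Rightarrow> real \<times> (real ^ 'n) \<Rightarrow> real \<times> (real ^ 'n) \<Rightarrow> real" where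
  "geodesic_dist R x x' = R * arcosh (minkowski x x' / R\<^sup>2)"


subsection \<open>Smooth functions\<close>

text \<open>\<open>Ck_on\<close> is meant for open sets only.\<close>

primrec Ck_on :: "nat \<Rightarrow> ('a::euclidean_space \<Rightarrow> real) \<Rightarrow> 'a set \<Rightarrow> bool" where
  "Ck_on 0 f S \<longleftrightarrow> continuous_on S f"
| "Ck_on (Suc k) f S \<longleftrightarrow>
     (\<forall>x\<in>S. f differentiable (at x)) \<and>
     (\<forall>b\<in>Basis. Ck_on k (\<lambda>x. frechet_derivative f (at x) b) S)"

definition smooth_on :: "('a::euclidean_space \<Rightarrow> real) \<Rightarrow> 'a set \<Rightarrow> bool" where
  "smooth_on f S \<longleftrightarrow> (\<forall>k. Ck_on k f S)"

text \<open>
  The hyperboloid is the graph of \<open>y \<mapsto> sqrt (R\<^sup>2 + |y|\<^sup>2)\<close>. So \<open>hyp_param R\<close> is a diffeomorphism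
  from \<^typ>\<open>real ^ 'n\<close> onto the submanifold \<open>hyperboloid R\<close>, and \<^const>\<open>snd\<close> restricted to
  \<open>hyperboloid R\<close>, its inverse, is a global chart. Smoothness, the metric, the volume measure and
  the Laplace-Beltrami operator are all expressed in this chart.
\<close>

definition hyp_param :: "real \<Rightarrow> real ^ 'n \<Rightarrow> real \<times> (real ^ 'n)" where
  "hyp_param R y = (sqrt (R\<^sup>2 + (norm y)\<^sup>2), y)"

definition smooth_on_hyperboloid :: "real \<Rightarrow> (real \<times> (real ^ 'n) \<Rightarrow> real) \<Rightarrow> bool" where
  "smooth_on_hyperboloid R f \<longleftrightarrow> smooth_on (\<lambda>y. f (hyp_param R y)) UNIV"

definition off_diagonal :: "real \<Rightarrow> ((real \<times> (real ^ 'n)) \<times> (real \<times> (real ^ 'n))) set" where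
  "off_diagonal R = hyperboloid R \<times> hyperboloid R - {(x, x) | x. x \<in> hyperboloid R}"

definition smooth_on_off_diagonal ::
    "real \<Rightarrow> ((real \<times> (real ^ 'n)) \<times> (real \<times> (real ^ 'n)) \<Rightarrow> real) \<Rightarrow> bool" where
  "smooth_on_off_diagonal R H \<longleftrightarrow>
     smooth_on (\<lambda>(y, y'). H (hyp_param R y, hyp_param R y')) {(y, y'). y \<noteq> y'}"


subsection \<open>Riemannian metric, volume measure and Laplace-Beltrami operator\<close>

text \<open>
  The Gram matrix, in the chart, of the restriction of \<open>-[\<cdot>,\<cdot>]\<close> to the tangent spaces.
\<close>

definition hyp_metric :: "real \<Rightarrow> real ^ 'n \<Rightarrow> real ^ 'n ^ 'n" where
  "hyp_metric R y = (\<chi> i j.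
     - minkowski (frechet_derivative (hyp_param R) (at y) (axis i 1))
                 (frechet_derivative (hyp_param R) (at y) (axis j 1)))"

definition vol_density :: "real \<Rightarrow> real ^ 'n \<Rightarrow> real" where
  "vol_density R y = sqrt (det (hyp_metric R y))"

definition hyp_vol :: "real \<Rightarrow> (real \<times> (real ^ 'n)) measure" where
  "hyp_vol R = distr (density lborel (\<lambda>y. ennreal (vol_density R y)))
                 (restrict_space borel (hyperboloid R)) (hyp_param R)"

definition partial_deriv :: "'n \<Rightarrow> (real ^ 'n \<Rightarrow> real) \<Rightarrow> real ^ 'n \<Rightarrow> real" where
  "partial_deriv i u y = frechet_derivative u (at y) (axis i 1)"

text \<open>
  The coordinate expression
  \<open>\<Delta>f = |g|\<^bsup>-1/2\<^esup> \<Sum>\<^sub>i \<partial>\<^sub>i (|g|\<^bsup>1/2\<^esup> \<Sum>\<^sub>j g\<^bsup>ij\<^esup> \<partial>\<^sub>j f)\<close>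
  of the divergence of the gradient. It does not depend on the coordinates; in geodesic polar
  coordinates, which are singular at \<open>r = 0\<close>, it reads
  \<open>R\<^bsup>-2\<^esup> (\<partial>\<^sub>r\<^sup>2 f + (d-1) coth r \<partial>\<^sub>r f + sinh\<^bsup>-2\<^esup> r \<Delta>\<^sub>S f)\<close>, where \<open>\<Delta>\<^sub>S\<close> is the
  Laplace-Beltrami operator of the unit sphere.
\<close>

definition laplace_beltrami ::
    "real \<Rightarrow> (real \<times> (real ^ 'n) \<Rightarrow> real) \<Rightarrow> real \<times> (real ^ 'n) \<Rightarrow> real" where
  "laplace_beltrami R f x =
     (1 / vol_density R (snd x)) *
     (\<Sum>i\<in>UNIV. partial_deriv i
        (\<lambda>z. vol_density R z *
           (\<Sum>j\<in>UNIV. matrix_inv (hyp_metric R z) $ i $ j *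
              partial_deriv j (\<lambda>y. f (hyp_param R y)) z))
        (snd x))"


subsection \<open>Distributions\<close>

text \<open>
  Below, \<open>u\<close> may be a function that is only meaningful off a point \<open>x'\<close> of the hyperboloid. Its
  value at \<open>x'\<close> is immaterial, since points are null sets of \<open>hyp_vol R\<close> and \<open>x'\<close> has distance
  \<open>0\<close> from itself.
\<close>

definition test_function :: "real \<Rightarrow> (real \<times> (real ^ 'n) \<Rightarrow> real) \<Rightarrow> bool" where
  "test_function R \<phi> \<longleftrightarrow> smooth_on_hyperboloid R \<phi> \<and>
     (\<exists>K. compact K \<and> K \<subseteq> hyperboloid R \<and> (\<forall>x\<in>hyperboloid R - K. \<phi> x = 0))"

definition locally_integrable :: "real \<Rightarrow> (real \<times> (real ^ 'n) \<Rightarrow> real) \<Rightarrow> bool" where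
  "locally_integrable R u \<longleftrightarrow>
     (\<forall>K. compact K \<and> K \<subseteq> hyperboloid R \<longrightarrow> set_integrable (hyp_vol R) K u)"

text \<open>\<open>-\<Delta>u = \<delta>\<^sub>g(\<cdot>, x')\<close> for the distribution given by a locally integrable \<open>u\<close>.\<close>

definition neg_laplacian_eq_dirac ::
    "real \<Rightarrow> (real \<times> (real ^ 'n) \<Rightarrow> real) \<Rightarrow> real \<times> (real ^ 'n) \<Rightarrow> bool" where
  "neg_laplacian_eq_dirac R u x' \<longleftrightarrow>
     (\<forall>\<phi>. test_function R \<phi> \<longrightarrow>
        (\<integral>x. u x * (- laplace_beltrami R \<phi> x) \<partial>hyp_vol R) = \<phi> x')"

definition vanishes_at_infinity ::
    "real \<Rightarrow> (real \<times> (real ^ 'n) \<Rightarrow> real) \<Rightarrow> real \<times> (real ^ 'n) \<Rightarrow> bool" where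
  "vanishes_at_infinity R u x' \<longleftrightarrow>
     (\<forall>\<epsilon>>0. \<exists>M>0. \<forall>x\<in>hyperboloid R. geodesic_dist R x x' > M \<longrightarrow> \<bar>u x\<bar> < \<epsilon>)"

end

theory Submission
  imports Defs
begin

text \<open>
  Work in the chart, and write \<open>t(a, y)\<close> for \<open>cosh (dist / R)\<close>. On radial functions \<open>F(t(a, \<cdot>))\<close> the
  Laplace-Beltrami operator is \<open>R\<^bsup>-2\<^esup> ((t\<^sup>2 - 1) F'' + d t F')\<close>, so \<open>G(a, y) = \<integral>\<^sub>t\<^sup>\<infinity> (s\<^sup>2 - 1)\<^bsup>-d/2\<^esup> ds\<close> is
  harmonic off \<open>a\<close>. Flatten \<open>G(a, \<cdot>)\<close> smoothly between the levels \<open>p\<close> and \<open>2p\<close> to a smooth function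
  \<open>g\<^sub>p\<close> that is constant near \<open>a\<close>: then \<open>k\<^sub>p = -\<Delta>g\<^sub>p \<ge> 0\<close> is supported in the shell \<open>p \<le> G \<le> 2p\<close>. Since
  \<open>g\<^sub>p - g\<^sub>q\<close> has compact support, the divergence theorem shows that the integral \<open>m(a)\<close> of \<open>k\<^sub>p\<close> does
  not depend on \<open>p\<close>. No polar coordinates are needed.

  As \<open>p \<rightarrow> \<infinity>\<close> the shell shrinks to \<open>a\<close>, and Green's identity gives \<open>-\<Delta>G(a, \<cdot>) = m(a) \<delta>\<^sub>a\<close>. Conversely, let
  \<open>-\<Delta>v = c \<delta>\<^sub>b\<close> with \<open>v\<close> vanishing at infinity, and test with \<open>g\<^sub>p - g\<^sub>q\<close> for the pole \<open>a \<noteq> b\<close>. As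
  \<open>p \<rightarrow> \<infinity>\<close> and \<open>q \<rightarrow> 0\<close> the shell of \<open>k\<^sub>q\<close> recedes to infinity, and \<open>m(a) v(a) = c G(a, b)\<close> results. With
  \<open>v = G(b, \<cdot>)\<close> and \<open>c = m(b)\<close> this shows that \<open>m\<close> is constant, with \<open>c = 1\<close> it is uniqueness. Neither
  Weyl's lemma nor a maximum principle enters.
\<close>

section \<open>Smooth functions and a smooth step\<close>

text \<open>The obstacle is the singularity of \<open>G\<close> at its pole: neither integrability
  there nor the strength of the delta is at hand without an integral in polar coordinates. Composing
  \<open>G\<close> with a function that is constant at high levels removes the singularity, so every
  identity is first obtained for smooth functions, where integration by parts is elementary. Since
  \<open>G\<close> is harmonic, \<open>p * cutoff (G / p)\<close> has as Laplacian the squared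
  gradient of \<open>G\<close> times \<open>cutoff'' (G / p) / p\<close>; concavity of
  \<open>cutoff\<close> gives the sign. Nonnegative kernels with a common total mass and shrinking
  support form an approximate identity whatever their shape, so the strength stays an unevaluated
  positive constant that is divided out at the end.

  Integrability at the pole comes from the same kernels: paired with a nonpositive test function
  that is strictly superharmonic near the pole, they bound the integrals of the truncations
  uniformly. For uniqueness the test function has its pole away from the singularity of the unknown,
  so that only continuity of the unknown at that pole is used.\<close>

lemma Ck_on_cong:
  assumes "open S" "\<And>x. x \<in> S \<Longrightarrow> f x = g x" "Ck_on k f S"
  shows "Ck_on k g S"
  using assms(2,3)
proof (induction k arbitrary: f g)
  case 0
  then show ?case by (simp cong: continuous_on_cong)
next
  case (Suc k)
  have d: "(g has_derivative frechet_derivative f (at x)) (at x)" if "x \<in> S" for x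
  proof -
    have "(f has_derivative frechet_derivative f (at x)) (at x)"
      using Suc.prems that by (simp add: frechet_derivative_works)
    then show ?thesis
      using has_derivative_transform_within_open[OF _ \<open>open S\<close> that] Suc.prems(1) by blast
  qed
  then have e: "frechet_derivative g (at x) = frechet_derivative f (at x)" if "x \<in> S" for x
    using that frechet_derivative_at by metis
  show ?case
    using Suc.IH[of "\<lambda>x. frechet_derivative f (at x) b" "\<lambda>x. frechet_derivative g (at x) b" for b]
      Suc.prems(2) d e by (auto simp: differentiable_def)
qed

text \<open>\<open>frechet_derivative\<close> is a choice. Replacing it by any explicitly known
  derivative lets the closure proofs below quote the usual differentiation rules.\<close>

lemma Ck_on_SucI:
  assumes "open S" "\<And>x. x \<in> S \<Longrightarrow> (f has_derivative f' x) (at x)"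
    "\<And>b. b \<in> Basis \<Longrightarrow> Ck_on k (\<lambda>x. f' x b) S"
  shows "Ck_on (Suc k) f S"
proof -
  have "frechet_derivative f (at x) = f' x" if "x \<in> S" for x
    using assms(2)[OF that] frechet_derivative_at by metis
  then have "Ck_on k (\<lambda>x. frechet_derivative f (at x) b) S" if "b \<in> Basis" for b
    by (intro Ck_on_cong[OF assms(1) _ assms(3)[OF that]]) simp
  then show ?thesis
    using assms(2) by (auto simp: differentiable_def)
qed

lemma Ck_on_Suc_has_derivative:
  assumes "Ck_on (Suc k) f S" "x \<in> S"
  shows "(f has_derivative frechet_derivative f (at x)) (at x)"
  using assms by (simp add: frechet_derivative_works)

lemma Ck_on_SucD: "Ck_on (Suc k) f S \<Longrightarrow> Ck_on k f S"
proof (induction k arbitrary: f)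
  case 0
  then show ?case
    by (auto intro!: continuous_at_imp_continuous_on differentiable_imp_continuous_within)
next
  case (Suc k)
  then show ?case by (auto simp del: Ck_on.simps(1) simp: Ck_on.simps(2))
qed

lemma Ck_on_const: "Ck_on k (\<lambda>x. c) S"
  by (induction k arbitrary: c) simp_all

lemma Ck_on_linear:
  assumes "open S" "bounded_linear f"
  shows "Ck_on k f S"
proof (cases k)
  case 0
  then show ?thesis
    using linear_continuous_on[OF assms(2)] by simp
next
  case (Suc k)
  show ?thesis unfolding Suc
    by (rule Ck_on_SucI[OF assms(1) bounded_linear_imp_has_derivative[OF assms(2)] Ck_on_const])
qed

lemma Ck_on_add:
  assumes "open S" "Ck_on k f S" "Ck_on k g S"
  shows "Ck_on k (\<lambda>x. f x + g x) S"
  using assms(2,3)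
proof (induction k arbitrary: f g)
  case 0
  then show ?case by (simp add: continuous_on_add)
next
  case (Suc k)
  then show ?case
    by (intro Ck_on_SucI[OF assms(1) has_derivative_add[OF Ck_on_Suc_has_derivative
        Ck_on_Suc_has_derivative]]) (assumption | simp)+
qed

lemma Ck_on_mult:
  assumes "open S" "Ck_on k f S" "Ck_on k g S"
  shows "Ck_on k (\<lambda>x. f x * g x) S"
  using assms(2,3)
proof (induction k arbitrary: f g)
  case 0
  then show ?case by (simp add: continuous_on_mult)
next
  case (Suc k)
  then have "Ck_on k f S" "Ck_on k g S"
    by (auto intro: Ck_on_SucD)
  with Suc show ?case
    by (intro Ck_on_SucI[OF assms(1) has_derivative_mult[OF Ck_on_Suc_has_derivative
        Ck_on_Suc_has_derivative]] Ck_on_add[OF assms(1)] Suc.IH) (assumption | simp)+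
qed

text \<open>An outer function of one real variable makes the chain rule a product of scalars, so the
  induction needs only \<open>Ck_on_mult\<close>. The outer function varies in the induction because
  its derivative takes its place.\<close>

lemma Ck_on_compose:
  fixes g :: "real \<Rightarrow> real"
  assumes "open S" "Ck_on k f S" "Ck_on k g U" "f ` S \<subseteq> U"
  shows "Ck_on k (\<lambda>x. g (f x)) S"
  using assms(2-3)
proof (induction k arbitrary: g)
  case 0
  then show ?case
    using assms(4) continuous_on_compose2 by (metis Ck_on.simps(1))
next
  case (Suc k)
  have d: "((\<lambda>x. g (f x)) has_derivative
      (\<lambda>v. frechet_derivative f (at x) v * frechet_derivative g (at (f x)) 1)) (at x)" if "x \<in> S" for x
  proof -
    have g: "(g has_derivative frechet_derivative g (at (f x))) (at (f x))"
      using Ck_on_Suc_has_derivative[OF Suc.prems(2)] that assms(4) by blast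
    have lin: "frechet_derivative g (at (f x)) u = u * frechet_derivative g (at (f x)) 1" for u
      using linear_cmul[OF has_derivative_linear[OF g], of u 1] by simp
    show ?thesis
      using diff_chain_at[OF Ck_on_Suc_has_derivative[OF Suc.prems(1) that] g]
      by (simp add: o_def lin[of "frechet_derivative f (at x) _"])
  qed
  show ?case
  proof (rule Ck_on_SucI[OF assms(1) d])
    fix b :: 'a assume "b \<in> Basis"
    then have "Ck_on k (\<lambda>x. frechet_derivative f (at x) b) S"
      using Suc.prems by simp
    moreover have "Ck_on k (\<lambda>x. frechet_derivative g (at (f x)) 1) S"
      using Suc.IH[OF Ck_on_SucD[OF Suc.prems(1)], of "\<lambda>z. frechet_derivative g (at z) 1"] Suc.prems
      by simp
    ultimately show "Ck_on k (\<lambda>x. frechet_derivative f (at x) b * frechet_derivative g (at (f x)) 1) S"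
      by (rule Ck_on_mult[OF assms(1)])
  qed
qed

lemma Ck_on_subset: "Ck_on k f S \<Longrightarrow> T \<subseteq> S \<Longrightarrow> Ck_on k f T"
  by (induction k arbitrary: f) (auto intro: continuous_on_subset)

text \<open>Smoothness is local. This glues the truncations \<open>gcut\<close> from a ball around
  the pole, where they are constant, and the punctured space.\<close>

lemma Ck_on_Un:
  assumes "open S" "open T" "Ck_on k f S" "Ck_on k f T"
  shows "Ck_on k f (S \<union> T)"
  using assms(3-4) by (induction k arbitrary: f) (auto intro: continuous_on_open_Un assms(1,2))

lemma smooth_onD: "smooth_on f S \<Longrightarrow> Ck_on k f S"
  by (simp add: smooth_on_def)

lemma smooth_on_imp_continuous_on: "smooth_on f S \<Longrightarrow> continuous_on S f"
  using smooth_onD[of f S 0] by simp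

lemma smooth_on_has_derivative:
  "smooth_on f S \<Longrightarrow> x \<in> S \<Longrightarrow> (f has_derivative frechet_derivative f (at x)) (at x)"
  by (intro Ck_on_Suc_has_derivative smooth_onD)

lemma smooth_on_derivative:
  assumes "smooth_on f S" "b \<in> Basis"
  shows "smooth_on (\<lambda>x. frechet_derivative f (at x) b) S"
  unfolding smooth_on_def
proof
  fix k
  show "Ck_on k (\<lambda>x. frechet_derivative f (at x) b) S"
    using smooth_onD[OF assms(1), of "Suc k"] assms(2) by simp
qed

lemma smooth_on_const: "smooth_on (\<lambda>x. c) S"
  by (simp add: smooth_on_def Ck_on_const)

lemma smooth_on_linear: "open S \<Longrightarrow> bounded_linear f \<Longrightarrow> smooth_on f S"
  by (simp add: smooth_on_def Ck_on_linear)

lemma smooth_on_add: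
  "open S \<Longrightarrow> smooth_on f S \<Longrightarrow> smooth_on g S \<Longrightarrow> smooth_on (\<lambda>x. f x + g x) S"
  by (simp add: smooth_on_def Ck_on_add)

lemma smooth_on_mult:
  "open S \<Longrightarrow> smooth_on f S \<Longrightarrow> smooth_on g S \<Longrightarrow> smooth_on (\<lambda>x. f x * g x) S"
  by (simp add: smooth_on_def Ck_on_mult)

lemma smooth_on_minus: "open S \<Longrightarrow> smooth_on f S \<Longrightarrow> smooth_on (\<lambda>x. - f x) S"
  using smooth_on_mult[OF _ smooth_on_const[of "-1"], of S f] by simp

lemma smooth_on_diff:
  "open S \<Longrightarrow> smooth_on f S \<Longrightarrow> smooth_on g S \<Longrightarrow> smooth_on (\<lambda>x. f x - g x) S"
  using smooth_on_add[OF _ _ smooth_on_minus, of S f g] by simp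

lemma smooth_on_sum:
  "open S \<Longrightarrow> (\<And>i. i \<in> I \<Longrightarrow> smooth_on (f i) S) \<Longrightarrow> smooth_on (\<lambda>x. \<Sum>i\<in>I. f i x) S"
  by (induction I rule: infinite_finite_induct) (simp_all add: smooth_on_const smooth_on_add)

lemma smooth_on_compose:
  fixes g :: "real \<Rightarrow> real"
  shows "open S \<Longrightarrow> smooth_on f S \<Longrightarrow> smooth_on g U \<Longrightarrow> f ` S \<subseteq> U \<Longrightarrow> smooth_on (\<lambda>x. g (f x)) S"
  by (auto simp: smooth_on_def intro: Ck_on_compose)

lemma smooth_on_subset: "smooth_on f S \<Longrightarrow> T \<subseteq> S \<Longrightarrow> smooth_on f T"
  by (auto simp: smooth_on_def intro: Ck_on_subset)

lemma smooth_on_cong: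
  "open S \<Longrightarrow> (\<And>x. x \<in> S \<Longrightarrow> f x = g x) \<Longrightarrow> smooth_on f S \<Longrightarrow> smooth_on g S"
  by (auto simp: smooth_on_def intro: Ck_on_cong)

lemma smooth_on_Un:
  "open S \<Longrightarrow> open T \<Longrightarrow> smooth_on f S \<Longrightarrow> smooth_on f T \<Longrightarrow> smooth_on f (S \<union> T)"
  by (auto simp: smooth_on_def intro: Ck_on_Un)

section \<open>Smooth functions of one real variable\<close>

lemma Ck_on_SucI_real:
  fixes f :: "real \<Rightarrow> real"
  assumes "open S" "\<And>x. x \<in> S \<Longrightarrow> (f has_real_derivative f' x) (at x)" "Ck_on k f' S"
  shows "Ck_on (Suc k) f S"
  by (rule Ck_on_SucI[OF assms(1), of _ "\<lambda>x. (*) (f' x)"])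
    (use assms(2,3) in \<open>auto simp: has_field_derivative_def\<close>)

lemma smooth_onI_real:
  fixes f :: "real \<Rightarrow> real"
  assumes "open S" "\<And>x. x \<in> S \<Longrightarrow> (f has_real_derivative f' x) (at x)" "smooth_on f' S"
  shows "smooth_on f S"
  unfolding smooth_on_def
proof
  fix k
  show "Ck_on k f S"
    by (rule Ck_on_SucD[OF Ck_on_SucI_real[OF assms(1,2)]]) (use assms(3) in \<open>auto simp: smooth_on_def\<close>)
qed

text \<open>The exponent is generalised since differentiation lowers it. Square roots, reciprocals
  and the powers of \<open>t\<^sup>2 - 1\<close> in the derivative of \<open>profile\<close> all
  come from this family.\<close>

lemma smooth_on_powr: "smooth_on (\<lambda>x::real. x powr a) {0<..}"
proof -
  have "Ck_on k (\<lambda>x::real. x powr a) {0<..}" for k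
  proof (induction k arbitrary: a)
    case 0
    then show ?case by (auto intro!: continuous_intros)
  next
    case (Suc k)
    show ?case
      by (rule Ck_on_SucI_real[where f' = "\<lambda>x. a * x powr (a - 1)"])
        (auto intro!: has_real_derivative_powr Ck_on_mult Ck_on_const Suc)
  qed
  then show ?thesis by (simp add: smooth_on_def)
qed

text \<open>For j = 0 this is the classical smooth function that is flat at 0. The powers of x in
  the denominator close the family under differentiation up to linear combinations
  (\<open>flat_deriv\<close>), as the induction in \<open>smooth_on_flat\<close> requires.\<close>

definition flat :: "nat \<Rightarrow> real \<Rightarrow> real" where
  "flat j x = (if x > 0 then exp (- 1 / x) / x ^ j else 0)"

lemma flat_pos: "x > 0 \<Longrightarrow> flat j x > 0" and flat_zero: "x \<le> 0 \<Longrightarrow> flat j x = 0"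
  by (auto simp: flat_def)

lemma flat_nonneg: "flat j x \<ge> 0"
  using flat_pos[of x j] flat_zero[of x j] by linarith

lemma flat_tendsto_0: "(flat j \<longlongrightarrow> 0) (at 0)"
proof -
  have 1: "((\<lambda>x. x ^ j / exp x) \<longlongrightarrow> (0::real)) at_top"
    by (rule tendsto_power_div_exp_0)
  \<comment> \<open>With u = 1/x the limit from the right becomes the decay of u^j / exp u at
    infinity.\<close>
  have 2: "((\<lambda>x::real. (inverse x) ^ j / exp (inverse x)) \<longlongrightarrow> 0) (at_right 0)"
    using filterlim_compose[OF 1 filterlim_inverse_at_top_right] by simp
  have "(flat j \<longlongrightarrow> 0) (at_right 0)"
    by (rule Lim_transform_eventually[OF 2])
      (auto simp: eventually_at_right_less flat_def divide_simps exp_minus intro!: eventually_at_rightI[of 0 1])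
  moreover have "(flat j \<longlongrightarrow> 0) (at_left 0)"
    by (rule Lim_transform_eventually[OF tendsto_const])
      (auto simp: flat_def intro!: eventually_at_leftI[of "-1"])
  ultimately show ?thesis
    by (simp add: filterlim_split_at)
qed

lemma flat_deriv: "(flat j has_real_derivative flat (j + 2) x - j * flat (j + 1) x) (at x)"
proof -
  consider "x > 0" | "x < 0" | "x = 0" by linarith
  then show ?thesis
  proof cases
    case 1
    have "((\<lambda>x. exp (- 1 / x) / x ^ j) has_real_derivative flat (j + 2) x - j * flat (j + 1) x) (at x)"
    proof -
      define c where "c = exp (- 1 / x)"
      have "((\<lambda>x. exp (- 1 / x)) has_real_derivative c / x\<^sup>2) (at x)"
        using 1 by (auto intro!: derivative_eq_intros simp: c_def power2_eq_square)
      then have "((\<lambda>x. exp (- 1 / x) / x ^ j) has_real_derivative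
          (c / x\<^sup>2 * x ^ j - c * (j * x ^ (j - 1))) / (x ^ j * x ^ j)) (at x)"
        unfolding c_def using 1 by (intro DERIV_divide DERIV_pow) auto
      moreover have "(c / x\<^sup>2 * x ^ j - c * (j * x ^ (j - 1))) / (x ^ j * x ^ j)
          = c / x ^ (j + 2) - j * (c / x ^ (j + 1))"
        using 1 by (cases j) (simp_all add: diff_divide_distrib power2_eq_square)
      ultimately show ?thesis using 1 by (simp add: flat_def c_def)
    qed
    then show ?thesis
      by (rule has_field_derivative_transform_within_open[of _ _ _ "{0<..}"]) (use 1 in \<open>auto simp: flat_def\<close>)
  next
    case 2
    have "((\<lambda>x. 0) has_real_derivative flat (j + 2) x - j * flat (j + 1) x) (at x)"
      using 2 by (simp add: flat_def)
    then show ?thesis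
      by (rule has_field_derivative_transform_within_open[of _ _ _ "{..<0}"]) (use 2 in \<open>auto simp: flat_def\<close>)
  next
    case 3
    \<comment> \<open>At 0 the difference quotient of \<open>flat j\<close> is
      \<open>flat (Suc j)\<close>, whose limit is known.\<close>
    have "((\<lambda>x. (flat j x - flat j 0) / (x - 0)) \<longlongrightarrow> 0) (at 0)"
      by (rule Lim_transform_eventually[OF flat_tendsto_0[of "Suc j"]])
        (auto simp: flat_def eventually_at_filter intro!: always_eventually)
    then show ?thesis
      using 3 by (simp add: has_field_derivative_iff flat_zero)
  qed
qed

lemma smooth_on_flat: "smooth_on (flat j) UNIV"
proof -
  have "Ck_on k (flat j) UNIV" for k
  proof (induction k arbitrary: j)
    case 0
    then show ?case
      by (auto intro!: continuous_at_imp_continuous_on DERIV_isCont[OF flat_deriv])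
  next
    case (Suc k)
    have "Ck_on k (\<lambda>x. flat (j + 2) x + (- real j) * flat (j + 1) x) UNIV"
      by (intro Ck_on_add Ck_on_mult Ck_on_const Suc) auto
    then show ?case
      by (intro Ck_on_SucI_real[OF _ flat_deriv]) auto
  qed
  then show ?thesis by (simp add: smooth_on_def)
qed

lemma smooth_on_inverse:
  assumes "open S" "smooth_on f S" "\<And>x. x \<in> S \<Longrightarrow> f x > 0"
  shows "smooth_on (\<lambda>x. inverse (f x)) S"
proof -
  have "smooth_on (\<lambda>x. f x powr (-1)) S"
    by (rule smooth_on_compose[OF assms(1,2) smooth_on_powr]) (use assms(3) in auto)
  then show ?thesis
    by (rule smooth_on_cong[OF assms(1), rotated]) (use assms(3) in \<open>auto simp: powr_minus less_imp_le\<close>)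
qed

definition smooth_step :: "real \<Rightarrow> real" where
  "smooth_step x = flat 0 x * inverse (flat 0 x + flat 0 (1 - x))"

lemma flat_sum_pos: "flat 0 x + flat 0 (1 - x) > 0"
  using flat_pos[of x 0] flat_pos[of "1 - x" 0] flat_nonneg[of 0 x] flat_nonneg[of 0 "1 - x"]
  by (cases "x > 0") linarith+

lemma smooth_on_smooth_step: "smooth_on smooth_step UNIV"
proof -
  have "smooth_on (\<lambda>x::real. 1 - x) UNIV"
    by (intro smooth_on_diff smooth_on_const smooth_on_linear) (auto intro: bounded_linear_ident)
  then have "smooth_on (\<lambda>x. flat 0 (1 - x)) UNIV"
    by (intro smooth_on_compose[OF _ _ smooth_on_flat]) auto
  then show ?thesis unfolding smooth_step_def[abs_def]
    using flat_sum_pos by (intro smooth_on_mult smooth_on_flat smooth_on_inverse smooth_on_add) auto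
qed

lemma smooth_step_deriv: "(smooth_step has_real_derivative deriv smooth_step x) (at x)"
  using smooth_on_has_derivative[OF smooth_on_smooth_step, of x] DERIV_deriv_iff_real_differentiable
  by (auto simp: differentiable_def)

lemma smooth_step_bounds: "0 \<le> smooth_step x" "smooth_step x \<le> 1"
  using flat_sum_pos[of x] flat_nonneg[of 0 x] flat_nonneg[of 0 "1 - x"]
  by (auto simp: smooth_step_def field_simps)

lemma smooth_step_eq_0: "x \<le> 0 \<Longrightarrow> smooth_step x = 0"
  by (simp add: smooth_step_def flat_zero)

lemma smooth_step_eq_1: "x \<ge> 1 \<Longrightarrow> smooth_step x = 1"
  using flat_sum_pos[of x] by (simp add: smooth_step_def flat_zero)

lemma mono_smooth_step: "mono smooth_step"
proof (rule monoI)
  have flat_mono: "flat 0 x \<le> flat 0 y" if "x \<le> y" for x y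
    using that by (auto simp: flat_def frac_le)
  fix x y :: real assume "x \<le> y"
  then have "flat 0 x * flat 0 (1 - y) \<le> flat 0 y * flat 0 (1 - x)"
    by (intro mult_mono flat_mono flat_nonneg) auto
  then show "smooth_step x \<le> smooth_step y"
    using flat_sum_pos[of x] flat_sum_pos[of y] by (simp add: smooth_step_def field_simps)
qed

text \<open>This sign makes \<open>cutoff\<close> concave and hence the kernels \<open>gker\<close>
  nonnegative.\<close>

lemma deriv_smooth_step_nonneg: "deriv smooth_step x \<ge> 0"
  by (intro mono_on_imp_deriv_nonneg[OF _ smooth_step_deriv, where A = UNIV])
    (use mono_smooth_step in auto)

text \<open>At these points the step attains its global minimum 0 or maximum 1. The argument
  includes the endpoints 0 and 1, where the step is not locally constant.\<close>

lemma deriv_smooth_step_eq_0: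
  assumes "x \<le> 0 \<or> x \<ge> 1"
  shows "deriv smooth_step x = 0"
  using assms
proof
  assume "x \<le> 0" then show ?thesis
    by (intro DERIV_local_min[OF smooth_step_deriv zero_less_one])
      (use smooth_step_eq_0 smooth_step_bounds in auto)
next
  assume "x \<ge> 1" then show ?thesis
    by (intro DERIV_local_max[OF smooth_step_deriv zero_less_one])
      (use smooth_step_eq_1 smooth_step_bounds in auto)
qed

section \<open>Compact support and integration by parts\<close>

definition compactly_supported :: "('a::real_normed_vector \<Rightarrow> real) \<Rightarrow> bool" where
  "compactly_supported f \<longleftrightarrow> (\<exists>r. \<forall>y. norm y > r \<longrightarrow> f y = 0)"

lemma compactly_supportedE:
  assumes "compactly_supported f"
  obtains r where "r > 0" "\<And>y. norm y > r \<Longrightarrow> f y = 0"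
proof -
  obtain r where r: "\<forall>y. norm y > r \<longrightarrow> f y = 0"
    using assms by (auto simp: compactly_supported_def)
  show thesis
    by (rule that[of "max r 1"]) (use r in auto)
qed

lemma compactly_supported_mult:
  "compactly_supported f \<Longrightarrow> compactly_supported (\<lambda>y. f y * g y)"
  "compactly_supported f \<Longrightarrow> compactly_supported (\<lambda>y. g y * f y)"
  by (auto simp: compactly_supported_def)

lemma compactly_supported_minus:
  "compactly_supported f \<Longrightarrow> compactly_supported (\<lambda>y. - f y)"
  by (auto simp: compactly_supported_def)

lemma compactly_supported_abs:
  "compactly_supported f \<Longrightarrow> compactly_supported (\<lambda>y. \<bar>f y\<bar>)"
  by (auto simp: compactly_supported_def)

lemma compactly_supported_sum:
  assumes "finite I" "\<And>i. i \<in> I \<Longrightarrow> compactly_supported (f i)"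
  shows "compactly_supported (\<lambda>y. \<Sum>i\<in>I. f i y)"
proof -
  have "\<exists>r. \<forall>i\<in>I. \<forall>y. norm y > r i \<longrightarrow> f i y = 0"
    using assms(2) by (intro bchoice) (auto simp: compactly_supported_def)
  then obtain r where r: "\<And>i y. i \<in> I \<Longrightarrow> norm y > r i \<Longrightarrow> f i y = 0" by blast
  have "(\<Sum>i\<in>I. f i y) = 0" if "norm y > (\<Sum>i\<in>I. \<bar>r i\<bar>)" for y
  proof (rule sum.neutral, rule ballI)
    fix i assume "i \<in> I"
    then have "\<bar>r i\<bar> \<le> (\<Sum>i\<in>I. \<bar>r i\<bar>)"
      using assms(1) by (intro member_le_sum) auto
    then show "f i y = 0" using that by (intro r \<open>i \<in> I\<close>) linarith
  qed
  then show ?thesis by (auto simp: compactly_supported_def)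
qed

lemma integrable_compactly_supported:
  fixes f :: "'a::euclidean_space \<Rightarrow> real"
  assumes "continuous_on UNIV f" "compactly_supported f"
  shows "integrable lborel f"
proof -
  obtain r where r: "r > 0" "\<And>y. norm y > r \<Longrightarrow> f y = 0"
    using compactly_supportedE[OF assms(2)] by blast
  have "integrable lborel (\<lambda>x. indicator (cball 0 r) x *\<^sub>R f x)"
    using assms(1) by (intro borel_integrable_compact) (auto intro: continuous_on_subset)
  moreover have "(\<lambda>x. indicator (cball 0 r) x *\<^sub>R f x) = f"
    using r by (auto simp: fun_eq_iff indicator_def)
  ultimately show ?thesis by simp
qed

lemma compactly_supported_bounded:
  fixes f :: "'a::euclidean_space \<Rightarrow> real"
  assumes "continuous_on UNIV f" "compactly_supported f"
  obtains B where "\<And>y. \<bar>f y\<bar> \<le> B"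
proof -
  obtain r where r: "r > 0" "\<And>y. norm y > r \<Longrightarrow> f y = 0"
    using compactly_supportedE[OF assms(2)] by blast
  have "bounded (f ` cball 0 r)"
    using assms(1) by (intro compact_imp_bounded compact_continuous_image)
      (auto intro: continuous_on_subset)
  then obtain B where B: "\<And>y. y \<in> cball 0 r \<Longrightarrow> \<bar>f y\<bar> \<le> B"
    unfolding bounded_iff by (metis imageI real_norm_def)
  have "\<bar>f y\<bar> \<le> B" for y
    using B[of y] B[of 0] r by (cases "norm y \<le> r") auto
  then show thesis by (rule that)
qed

section \<open>Partial derivatives and integration by parts\<close>

lemma partial_deriv_eqI: "(u has_derivative D) (at y) \<Longrightarrow> partial_deriv i u y = D (axis i 1)"
  unfolding partial_deriv_def using frechet_derivative_at by metis

text \<open>The two functions have the same derivatives at y, so the choice inside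
  \<open>frechet_derivative\<close> selects the same map, even at a point where there is no
  derivative.\<close>

lemma partial_deriv_cong:
  assumes "open S" "y \<in> S" "\<And>z. z \<in> S \<Longrightarrow> f z = g z"
  shows "partial_deriv i f y = partial_deriv i g y"
proof -
  have "(f has_derivative D) (at y) \<longleftrightarrow> (g has_derivative D) (at y)" for D
  proof
    show "(g has_derivative D) (at y)" if "(f has_derivative D) (at y)"
      using that assms by (rule has_derivative_transform_within_open) auto
    show "(f has_derivative D) (at y)" if "(g has_derivative D) (at y)"
      using that assms(1,2) by (rule has_derivative_transform_within_open) (use assms(3) in auto)
  qed
  then show ?thesis by (simp add: partial_deriv_def frechet_derivative_def)
qed

lemma smooth_on_partial_deriv: "smooth_on f S \<Longrightarrow> smooth_on (partial_deriv i f) S"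
  unfolding partial_deriv_def by (intro smooth_on_derivative) (auto simp: axis_in_Basis_iff)

lemma partial_deriv_mult:
  assumes "f differentiable (at y)" "g differentiable (at y)"
  shows "partial_deriv i (\<lambda>z. f z * g z) y = f y * partial_deriv i g y + partial_deriv i f y * g y"
  using assms unfolding frechet_derivative_works
  by (subst partial_deriv_eqI[OF has_derivative_mult]) (auto simp: partial_deriv_def)

lemma smooth_on_differentiable: "smooth_on f S \<Longrightarrow> x \<in> S \<Longrightarrow> f differentiable (at x)"
  using smooth_on_has_derivative differentiableI by blast

lemma compactly_supported_partial_deriv:
  assumes "compactly_supported f"
  shows "compactly_supported (partial_deriv i f)"
proof -
  obtain r where r: "r > 0" "\<And>y. norm y > r \<Longrightarrow> f y = 0"
    using compactly_supportedE[OF assms] by blast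
  have "partial_deriv i f y = 0" if "norm y > r" for y
  proof -
    have "partial_deriv i f y = partial_deriv i (\<lambda>z. 0) y"
      by (rule partial_deriv_cong[of "{z. norm z > r}"])
        (use that r in \<open>auto intro!: open_Collect_less continuous_intros\<close>)
    also have "\<dots> = 0" by (subst partial_deriv_eqI[OF has_derivative_const]) simp
    finally show ?thesis .
  qed
  then show ?thesis by (auto simp: compactly_supported_def)
qed

text \<open>The integral of the difference quotient vanishes by translation invariance.\<close>

lemma integral_partial_deriv_eq_0:
  fixes u :: "real ^ 'n::finite \<Rightarrow> real"
  assumes u: "smooth_on u UNIV" "compactly_supported u"
  shows "(\<integral>y. partial_deriv i u y \<partial>lborel) = 0"
proof -
  define e where "e = (axis i 1 :: real ^ 'n)"
  have ne: "norm e = 1" by (simp add: e_def norm_axis_1)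
  obtain r where r: "r > 0" "\<And>y. norm y > r \<Longrightarrow> u y = 0"
    using compactly_supportedE[OF u(2)] by blast
  have cu: "continuous_on UNIV u" and cd: "continuous_on UNIV (partial_deriv i u)"
    using u(1) smooth_on_partial_deriv smooth_on_imp_continuous_on by blast+
  obtain B where B: "\<And>y. \<bar>partial_deriv i u y\<bar> \<le> B"
    using compactly_supported_bounded[OF cd compactly_supported_partial_deriv[OF u(2)]] by blast
  have iu: "integrable lborel u"
    using integrable_compactly_supported[OF cu u(2)] .
  have der: "((\<lambda>t. u (y + t *\<^sub>R e)) has_real_derivative partial_deriv i u (y + t *\<^sub>R e)) (at t)" for y t
  proof -
    let ?D = "frechet_derivative u (at (y + t *\<^sub>R e))"
    have D: "(u has_derivative ?D) (at (y + t *\<^sub>R e))"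
      using smooth_on_has_derivative[OF u(1)] by simp
    have "((\<lambda>t. u (y + t *\<^sub>R e)) has_derivative (\<lambda>s. ?D (s *\<^sub>R e))) (at t)"
      by (rule has_derivative_compose[where f = "\<lambda>t. y + t *\<^sub>R e", OF _ D]) (auto intro!: derivative_eq_intros)
    moreover have "?D (s *\<^sub>R e) = partial_deriv i u (y + t *\<^sub>R e) * s" for s
      using linear_cmul[OF has_derivative_linear[OF D], of s e] by (simp add: partial_deriv_def e_def)
    ultimately show ?thesis by (simp add: has_field_derivative_def)
  qed
  define q where "q n y = real (Suc n) * (u (y + inverse (real (Suc n)) *\<^sub>R e) - u y)" for n y
  have shift: "integrable lborel (\<lambda>y. u (y + v)) \<and> (\<integral>y. u (y + v) \<partial>lborel) = (\<integral>y. u y \<partial>lborel)" for v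
  proof -
    have "integrable (distr lborel borel ((+) v)) u"
      using iu by (simp add: lborel_distr_plus)
    then have "integrable lborel (\<lambda>y. u (v + y))"
      using cu by (subst (asm) integrable_distr_eq) (auto simp: borel_measurable_continuous_onI)
    moreover have "(\<integral>y. u y \<partial>lborel) = (\<integral>y. u (v + y) \<partial>lborel)"
      by (subst lborel_distr_plus[of v, symmetric], subst integral_distr)
        (use cu in \<open>auto simp: borel_measurable_continuous_onI\<close>)
    ultimately show ?thesis by (simp add: add.commute)
  qed
  have q0: "(\<integral>y. q n y \<partial>lborel) = 0" for n
    using shift[of "inverse (real (Suc n)) *\<^sub>R e"] iu by (simp add: q_def)
  have lim: "(\<lambda>n. q n y) \<longlonglongrightarrow> partial_deriv i u y" for y
  proof -
    have "((\<lambda>t. (u (y + t *\<^sub>R e) - u y) / t) \<longlongrightarrow> partial_deriv i u y) (at 0)"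
      using der[of y 0] by (simp add: has_field_derivative_iff)
    moreover have "filterlim (\<lambda>n. inverse (real (Suc n))) (at 0) sequentially"
      using LIMSEQ_inverse_real_of_nat by (simp add: filterlim_at)
    ultimately have "(\<lambda>n. (u (y + inverse (real (Suc n)) *\<^sub>R e) - u y) / inverse (real (Suc n)))
        \<longlonglongrightarrow> partial_deriv i u y"
      by (rule filterlim_compose)
    then show ?thesis by (simp add: q_def divide_simps mult.commute del: of_nat_Suc)
  qed
  \<comment> \<open>The mean value theorem bounds the quotients by B, and a shift of length at most
    1 keeps their supports inside the ball of radius r + 1. This is the dominating function.\<close>
  have bd: "norm (q n y) \<le> indicator (cball 0 (r + 1)) y * B" for n y
  proof -
    let ?t = "inverse (real (Suc n))"
    have t: "0 < ?t" "?t \<le> 1" by (auto simp: divide_simps)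
    obtain z where "u (y + ?t *\<^sub>R e) - u (y + 0 *\<^sub>R e) = (?t - 0) * partial_deriv i u (y + z *\<^sub>R e)"
      using MVT2[OF t(1) der[of y]] by blast
    then have "q n y = partial_deriv i u (y + z *\<^sub>R e)"
      by (simp add: q_def del: of_nat_Suc)
    then have 1: "\<bar>q n y\<bar> \<le> B" using B by simp
    show ?thesis
    proof (cases "norm y \<le> r + 1")
      case True then show ?thesis using 1 by simp
    next
      case False
      have "norm y \<le> norm (y + ?t *\<^sub>R e) + norm (?t *\<^sub>R e)"
        using norm_triangle_ineq4[of "y + ?t *\<^sub>R e" "?t *\<^sub>R e"] by simp
      also have "norm (?t *\<^sub>R e) \<le> 1" using t ne by simp
      finally have "norm (y + ?t *\<^sub>R e) > r" using False by linarith
      then have "q n y = 0" using r(2)[of y] r(2)[of "y + ?t *\<^sub>R e"] False by (simp add: q_def)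
      then show ?thesis using False by simp
    qed
  qed
  have "(\<lambda>n. \<integral>y. q n y \<partial>lborel) \<longlonglongrightarrow> (\<integral>y. partial_deriv i u y \<partial>lborel)"
  proof (rule integral_dominated_convergence[where w = "\<lambda>y. indicator (cball 0 (r + 1)) y * B"])
    show "partial_deriv i u \<in> borel_measurable lborel"
      using cd by (simp add: borel_measurable_continuous_onI)
    have "continuous_on UNIV (q n)" for n
      unfolding q_def by (intro continuous_intros continuous_on_compose2[OF cu]) auto
    then show "q n \<in> borel_measurable lborel" for n
      by (simp add: borel_measurable_continuous_onI)
    show "integrable lborel (\<lambda>y::real ^ 'n. indicator (cball 0 (r + 1)) y * B)"
      using borel_integrable_compact[OF compact_cball continuous_on_const,
        of "0::real ^ 'n" "r + 1" B] by (simp only: real_scaleR_def)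
  qed (use lim bd in auto)
  then show ?thesis using q0 by (simp add: LIMSEQ_const_iff)
qed

text \<open>Compact support of one factor passes to all three products. The other factor stays free,
  as Green's identity for a truncation \<open>gcut\<close>, which never has compact support,
  demands.\<close>

lemma integral_by_parts_compact:
  fixes f w :: "real ^ 'n::finite \<Rightarrow> real"
  assumes f: "smooth_on f UNIV" and w: "smooth_on w UNIV"
    and c: "compactly_supported f \<or> compactly_supported w"
  shows "integrable lborel (\<lambda>y. f y * partial_deriv i w y)"
    "integrable lborel (\<lambda>y. partial_deriv i f y * w y)"
    "(\<integral>y. f y * partial_deriv i w y \<partial>lborel) = - (\<integral>y. partial_deriv i f y * w y \<partial>lborel)"
proof -
  have cs: "compactly_supported (\<lambda>y. f y * partial_deriv i w y)"
    "compactly_supported (\<lambda>y. partial_deriv i f y * w y)" "compactly_supported (\<lambda>y. f y * w y)"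
    using c compactly_supported_partial_deriv[of _ i] compactly_supported_mult by blast+
  have sm: "smooth_on (\<lambda>y. f y * partial_deriv i w y) UNIV"
    "smooth_on (\<lambda>y. partial_deriv i f y * w y) UNIV" "smooth_on (\<lambda>y. f y * w y) UNIV"
    using f w by (auto intro!: smooth_on_mult smooth_on_partial_deriv)
  show 1: "integrable lborel (\<lambda>y. f y * partial_deriv i w y)"
    and 2: "integrable lborel (\<lambda>y. partial_deriv i f y * w y)"
    using cs sm by (auto intro: integrable_compactly_supported smooth_on_imp_continuous_on)
  have "partial_deriv i (\<lambda>y. f y * w y) y = f y * partial_deriv i w y + partial_deriv i f y * w y" for y
    using f w by (intro partial_deriv_mult smooth_on_differentiable) auto
  then have "(\<integral>y. f y * partial_deriv i w y + partial_deriv i f y * w y \<partial>lborel) = 0"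
    using integral_partial_deriv_eq_0[OF sm(3) cs(3), of i] by simp
  then show "(\<integral>y. f y * partial_deriv i w y \<partial>lborel) = - (\<integral>y. partial_deriv i f y * w y \<partial>lborel)"
    using 1 2 by simp
qed

section \<open>The Laplace-Beltrami operator in the chart\<close>

locale hyperbolic_chart =
  fixes R :: real
  assumes R_pos: "R > 0"
begin

definition height :: "real ^ 'n \<Rightarrow> real" where
  "height y = sqrt (R\<^sup>2 + (norm y)\<^sup>2)"

text \<open>\<open>cosh (dist / R)\<close> in the chart.\<close>

definition coshd :: "real ^ 'n \<Rightarrow> real ^ 'n \<Rightarrow> real" where
  "coshd a y = (height a * height y - a \<bullet> y) / R\<^sup>2"

text \<open>The closed form of \<open>vol_density\<close> (see
  \<open>vol_density_eq\<close>).\<close>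

definition dens :: "real ^ 'n \<Rightarrow> real" where
  "dens y = R / height y"

text \<open>The inverse of the Gram matrix I - y y^T / (height y)^2 by the rank-one update formula,
  where (height y)^2 - |y|^2 = R^2; verified in \<open>matrix_inv_hyp_metric\<close>.\<close>

definition ginv :: "real ^ 'n \<Rightarrow> 'n \<Rightarrow> 'n \<Rightarrow> real" where
  "ginv z i j = (if i = j then 1 else 0) + z $ i * z $ j / R\<^sup>2"

text \<open>This is \<open>dens\<close> times the Laplace-Beltrami operator. With the volume density
  absorbed, all integrals are taken against \<open>lborel\<close>, and the operator is symmetric
  there.\<close>

definition lapl :: "(real ^ 'n \<Rightarrow> real) \<Rightarrow> real ^ 'n \<Rightarrow> real" where
  "lapl f y = (\<Sum>i\<in>UNIV. partial_deriv i
      (\<lambda>z. dens z * (\<Sum>j\<in>UNIV. ginv z i j * partial_deriv j f z)) y)"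

section \<open>Comparison of \<open>coshd\<close> with the Euclidean norm of the chart\<close>

lemma height_sq: "(height y)\<^sup>2 = R\<^sup>2 + (norm y)\<^sup>2"
  by (simp add: height_def)

lemma height_ge: "R \<le> height y" "norm y \<le> height y"
  using R_pos by (auto simp: height_def intro!: real_le_rsqrt)

lemma height_pos: "height y > 0"
  using height_ge(1)[of y] R_pos by linarith

lemma height_nonzero [simp]: "height y \<noteq> 0"
  using height_pos[of y] by simp

lemma R_nonzero [simp]: "R \<noteq> 0"
  using R_pos by simp

lemma dens_pos: "dens y > 0"
  using R_pos height_pos[of y] by (simp add: dens_def)

lemma dens_le_1: "dens y \<le> 1"
  using height_ge(1)[of y] height_pos[of y] by (simp add: dens_def)

lemma coshd_commute: "coshd a y = coshd y a"
  by (simp add: coshd_def inner_commute mult.commute)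

lemma coshd_self: "coshd a a = 1"
  using height_sq[of a] by (simp add: coshd_def power2_eq_square[symmetric] power2_norm_eq_inner)

lemma inner_eq_coshd: "a \<bullet> y = height a * height y - R\<^sup>2 * coshd a y"
  by (simp add: coshd_def)

text \<open>By Cauchy-Schwarz, R^2 |a - y|^2 is at most the difference of squares (height a * height
  y)^2 - (R^2 + a.y)^2, one factor of which is R^2 (coshd a y - 1). The bound
  \<open>coshd_ge_1\<close>, its equality case and the concentration at a all follow from
  it.\<close>

lemma coshd_norm_diff:
  "(norm (a - y))\<^sup>2 \<le> (coshd a y - 1) * (height a * height y + R\<^sup>2 + a \<bullet> y)"
proof -
  have "(a \<bullet> y)\<^sup>2 \<le> (norm a)\<^sup>2 * (norm y)\<^sup>2"
    using Cauchy_Schwarz_ineq[of a y] by (simp add: power2_norm_eq_inner)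
  moreover have h: "(height a * height y)\<^sup>2 = (R\<^sup>2 + (norm a)\<^sup>2) * (R\<^sup>2 + (norm y)\<^sup>2)"
    by (simp add: power_mult_distrib height_sq)
  moreover have e: "(norm (a - y))\<^sup>2 = (norm a)\<^sup>2 + (norm y)\<^sup>2 - 2 * (a \<bullet> y)"
    by (simp add: power2_norm_eq_inner inner_diff inner_commute)
  ultimately have "R\<^sup>2 * (norm (a - y))\<^sup>2 \<le> (height a * height y)\<^sup>2 - (R\<^sup>2 + a \<bullet> y)\<^sup>2"
    unfolding h e by (simp add: algebra_simps power2_eq_square)
  also have "\<dots> = R\<^sup>2 * ((coshd a y - 1) * (height a * height y + R\<^sup>2 + a \<bullet> y))"
    by (simp add: coshd_def field_simps power2_eq_square)
  finally show ?thesis using R_pos by simp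
qed

lemma height_le: "height y \<le> R + norm y"
  using sqrt_add_le_add_sqrt[of "R\<^sup>2" "(norm y)\<^sup>2"] R_pos by (simp add: height_def)

lemma inner_le_height: "\<bar>a \<bullet> y\<bar> \<le> height a * height y"
  using Cauchy_Schwarz_ineq2[of a y] mult_mono[OF height_ge(2)[of a] height_ge(2)[of y]] height_pos[of a]
  by simp

lemma coshd_ge_1: "coshd a y \<ge> 1"
proof (rule ccontr)
  assume "\<not> ?thesis"
  moreover have "height a * height y + R\<^sup>2 + a \<bullet> y > 0"
    using inner_le_height[of a y] R_pos by (smt (verit) zero_less_power)
  ultimately have "(coshd a y - 1) * (height a * height y + R\<^sup>2 + a \<bullet> y) < 0"
    by (simp add: mult_less_0_iff)
  then show False using coshd_norm_diff[of a y] by (smt (verit) zero_le_power2)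
qed

lemma coshd_eq_1_iff: "coshd a y = 1 \<longleftrightarrow> a = y"
  using coshd_norm_diff[of a y] by (auto simp: coshd_self)

lemma coshd_gt_1: "y \<noteq> a \<Longrightarrow> coshd a y > 1"
  using coshd_ge_1[of a y] coshd_eq_1_iff[of a y] by fastforce

lemma coshd_upper: "R\<^sup>2 * coshd a y \<le> 2 * (height a * height y)"
  using inner_le_height[of a y] by (simp add: coshd_def)

text \<open>Write R^2 as (height a - |a|)(height a + |a|) and use a.y <= |a| height y. Hence
  sublevel sets of \<open>coshd a\<close> are bounded; together with \<open>coshd_upper\<close>,
  tending to infinity means the same in the hyperbolic distance and in the chart.\<close>

lemma coshd_lower: "height y \<le> 2 * height a * coshd a y"
proof -
  have "R\<^sup>2 * height y = (height a - norm a) * (height a + norm a) * height y"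
    using height_sq[of a] by (simp add: algebra_simps power2_eq_square)
  also have "\<dots> = (height a * height y - norm a * height y) * (height a + norm a)"
    by (simp add: algebra_simps)
  also have "\<dots> \<le> (height a * height y - a \<bullet> y) * (height a + norm a)"
  proof (rule mult_right_mono)
    have "a \<bullet> y \<le> norm a * height y"
      using norm_cauchy_schwarz[of a y] mult_left_mono[OF height_ge(2)[of y] norm_ge_zero[of a]] by linarith
    then show "height a * height y - norm a * height y \<le> height a * height y - a \<bullet> y" by simp
  qed (use height_pos[of a] in simp)
  also have "\<dots> \<le> (R\<^sup>2 * coshd a y) * (2 * height a)"
    using coshd_ge_1[of a y] height_ge(2)[of a]
    by (simp add: inner_eq_coshd)
  finally have "R\<^sup>2 * height y \<le> R\<^sup>2 * (2 * height a * coshd a y)"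
    by (simp add: mult_ac)
  then show ?thesis using R_pos by simp
qed

lemma coshd_concentrated:
  assumes "r > 0"
  shows "\<exists>t0>1. \<forall>y. coshd a y \<le> t0 \<longrightarrow> norm (a - y) < r"
proof -
  \<comment> \<open>When coshd a y <= 2, \<open>coshd_lower\<close> gives height y <= 4 * height a,
    so C bounds the second factor in \<open>coshd_norm_diff\<close>.\<close>
  define C where "C = 8 * (height a)\<^sup>2 + R\<^sup>2"
  have C: "C > 0" unfolding C_def using R_pos by (intro add_nonneg_pos) auto
  define t0 where "t0 = min 2 (1 + r\<^sup>2 / (2 * C))"
  have t0: "t0 > 1" "t0 \<le> 2" "(t0 - 1) * C < r\<^sup>2"
  proof -
    have "r\<^sup>2 > 0" using assms by simp
    then show "t0 > 1" "t0 \<le> 2" using C by (auto simp: t0_def)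
    have "(t0 - 1) * C \<le> r\<^sup>2 / (2 * C) * C"
      using C by (intro mult_right_mono) (auto simp: t0_def)
    also have "\<dots> < r\<^sup>2" using C \<open>r\<^sup>2 > 0\<close> by simp
    finally show "(t0 - 1) * C < r\<^sup>2" .
  qed
  have "norm (a - y) < r" if y: "coshd a y \<le> t0" for y
  proof -
    have "height y \<le> 4 * height a"
      using coshd_lower[of y a] y t0(2) height_pos[of a] mult_left_mono[of "coshd a y" 2 "2 * height a"]
      by linarith
    then have "height a * height y \<le> 4 * (height a)\<^sup>2"
      using mult_left_mono[of "height y" "4 * height a" "height a"] height_pos[of a]
      by (simp add: power2_eq_square)
    then have "height a * height y + R\<^sup>2 + a \<bullet> y \<le> C"
      using inner_le_height[of a y] unfolding C_def by linarith
    then have "(coshd a y - 1) * (height a * height y + R\<^sup>2 + a \<bullet> y) \<le> (t0 - 1) * C"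
      using y coshd_ge_1[of a y] t0(1) C inner_le_height[of a y] zero_le_power2[of R]
      by (intro mult_mono) linarith+
    then have "(norm (a - y))\<^sup>2 < r\<^sup>2"
      using coshd_norm_diff[of a y] t0(3) by linarith
    then show ?thesis using assms by (simp add: power2_less_imp_less)
  qed
  then show ?thesis using t0(1) by blast
qed

lemma height_has_derivative:
  "(height has_derivative (\<lambda>v. (y \<bullet> v) / height y)) (at y)"
proof -
  have "((\<lambda>z. R\<^sup>2 + z \<bullet> z) has_derivative (\<lambda>v. 2 * (y \<bullet> v))) (at y)"
    by (auto intro!: derivative_eq_intros simp: inner_commute)
  moreover have "R\<^sup>2 + y \<bullet> y > 0"
    using R_pos by (intro add_pos_nonneg) auto
  ultimately have "((\<lambda>z. sqrt (R\<^sup>2 + z \<bullet> z)) has_derivative (\<lambda>v. (y \<bullet> v) / sqrt (R\<^sup>2 + y \<bullet> y))) (at y)"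
    by (auto intro!: derivative_eq_intros simp: field_simps inner_commute)
  then show ?thesis
    unfolding height_def power2_norm_eq_inner by simp
qed

lemma coshd_has_derivative:
  "(coshd a has_derivative (\<lambda>v. (height a / height y * (y \<bullet> v) - a \<bullet> v) / R\<^sup>2)) (at y)"
  unfolding coshd_def[abs_def]
  by (auto intro!: derivative_eq_intros height_has_derivative simp: field_simps)

text \<open>Precomposition with a linear map is included for the two projections of a pair of
  points, which the joint smoothness of G needs.\<close>

lemma smooth_on_height_linear:
  fixes f :: "'a::euclidean_space \<Rightarrow> real ^ 'n"
  assumes "bounded_linear f"
  shows "smooth_on (\<lambda>z. height (f z)) UNIV"
proof -
  have "smooth_on (\<lambda>z. (R\<^sup>2 + (\<Sum>i\<in>UNIV. f z $ i * f z $ i))) UNIV"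
    by (intro smooth_on_add smooth_on_const smooth_on_sum smooth_on_mult smooth_on_linear
        bounded_linear_compose[OF bounded_linear_vec_nth assms]) auto
  then have "smooth_on (\<lambda>z. (R\<^sup>2 + (\<Sum>i\<in>UNIV. f z $ i * f z $ i)) powr (1/2)) UNIV"
    by (intro smooth_on_compose[where g = "\<lambda>x. x powr (1/2)", OF open_UNIV _ smooth_on_powr])
      (use R_pos in \<open>auto intro!: add_pos_nonneg sum_nonneg\<close>)
  then show ?thesis
    by (rule smooth_on_cong[OF open_UNIV, rotated])
      (auto simp: height_def powr_half_sqrt power2_norm_eq_inner inner_vec_def sum_nonneg)
qed

lemma smooth_on_height: "smooth_on height UNIV"
  using smooth_on_height_linear[OF bounded_linear_ident] by simp

lemma smooth_on_coshd: "smooth_on (coshd a) UNIV"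
proof -
  have "smooth_on (\<lambda>y. (height a * height y - a \<bullet> y) * (1 / R\<^sup>2)) UNIV"
    by (intro smooth_on_diff smooth_on_const smooth_on_mult smooth_on_linear smooth_on_height
        bounded_linear_inner_right) auto
  then show ?thesis by (rule smooth_on_cong[OF open_UNIV, rotated]) (simp add: coshd_def)
qed

lemma continuous_on_coshd: "continuous_on S (coshd a)"
  using smooth_on_imp_continuous_on[OF smooth_on_coshd] continuous_on_subset by blast

lemma smooth_on_dens: "smooth_on dens UNIV"
proof -
  have "smooth_on (\<lambda>y. R * inverse (height y)) UNIV"
    by (intro smooth_on_mult smooth_on_const smooth_on_inverse smooth_on_height height_pos) auto
  then show ?thesis by (rule smooth_on_cong[OF open_UNIV, rotated]) (simp add: dens_def field_simps)
qed

lemma smooth_on_ginv: "smooth_on (\<lambda>z. ginv z i j) UNIV"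
proof -
  have "smooth_on (\<lambda>z. (if i = j then 1 else 0) + z $ i * z $ j * (1 / R\<^sup>2)) UNIV"
    by (intro smooth_on_add smooth_on_const smooth_on_mult smooth_on_linear bounded_linear_vec_nth) auto
  then show ?thesis by (rule smooth_on_cong[OF open_UNIV, rotated]) (simp add: ginv_def)
qed

lemma smooth_on_flux:
  assumes "smooth_on f UNIV"
  shows "smooth_on (\<lambda>z. dens z * (\<Sum>j\<in>UNIV. ginv z i j * partial_deriv j f z)) UNIV"
  by (intro smooth_on_mult smooth_on_sum smooth_on_dens smooth_on_ginv smooth_on_partial_deriv assms) auto

lemma smooth_on_lapl: "smooth_on f UNIV \<Longrightarrow> smooth_on (lapl f) UNIV"
  unfolding lapl_def[abs_def] by (intro smooth_on_sum smooth_on_partial_deriv smooth_on_flux) auto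

lemma compactly_supported_lapl:
  "compactly_supported f \<Longrightarrow> compactly_supported (lapl f)"
  unfolding lapl_def[abs_def]
  by (intro compactly_supported_sum compactly_supported_partial_deriv compactly_supported_mult) auto

lemma lapl_cong:
  assumes "open S" "y \<in> S" "\<And>z. z \<in> S \<Longrightarrow> f z = g z"
  shows "lapl f y = lapl g y"
proof -
  have "partial_deriv j f z = partial_deriv j g z" if "z \<in> S" for z j
    using partial_deriv_cong[OF assms(1) that assms(3)] .
  then show ?thesis unfolding lapl_def
    by (intro sum.cong refl partial_deriv_cong[OF assms(1,2)]) auto
qed

lemma lapl_const:
  fixes y :: "real ^ 'n"
  shows "lapl (\<lambda>z. c) y = 0"
proof -
  have "partial_deriv i (\<lambda>z. c) z = 0" for c :: real and i and z :: "real ^ 'n"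
    by (subst partial_deriv_eqI[OF has_derivative_const]) simp
  then show ?thesis by (simp add: lapl_def)
qed

lemma lapl_diff:
  assumes "smooth_on f UNIV" "smooth_on g UNIV"
  shows "lapl (\<lambda>z. f z - g z) y = lapl f y - lapl g y"
proof -
  have pd: "partial_deriv i (\<lambda>z. u z - v z) z = partial_deriv i u z - partial_deriv i v z"
    if "smooth_on u UNIV" "smooth_on v UNIV" for i u v and z :: "real ^ 'n"
    using that[THEN smooth_on_has_derivative, of z]
    by (subst partial_deriv_eqI[OF has_derivative_diff]) (auto simp: partial_deriv_def)
  have "lapl (\<lambda>z. f z - g z) y = (\<Sum>i\<in>UNIV. partial_deriv i
      (\<lambda>z. dens z * (\<Sum>j\<in>UNIV. ginv z i j * partial_deriv j f z)
         - dens z * (\<Sum>j\<in>UNIV. ginv z i j * partial_deriv j g z)) y)"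
    unfolding lapl_def by (simp add: pd[OF assms] sum_subtractf right_diff_distrib)
  also have "\<dots> = lapl f y - lapl g y"
    by (simp add: pd[OF smooth_on_flux[OF assms(1)] smooth_on_flux[OF assms(2)]] sum_subtractf lapl_def)
  finally show ?thesis .
qed

section \<open>Green's identity and the divergence theorem\<close>

lemma ginv_commute: "ginv z i j = ginv z j i"
  by (simp add: ginv_def mult.commute)

text \<open>Integrating the divergence by parts leaves the Dirichlet form, which is symmetric in f
  and \<phi>. The support condition is symmetric as well, so \<open>green\<close> may apply this in
  both orders.\<close>

lemma green_aux:
  fixes f \<phi> :: "real ^ 'n \<Rightarrow> real"
  assumes f: "smooth_on f UNIV" and \<phi>: "smooth_on \<phi> UNIV"
    and c: "compactly_supported f \<or> compactly_supported \<phi>"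
  shows "(\<integral>y. f y * lapl \<phi> y \<partial>lborel)
    = - (\<integral>y. dens y * (\<Sum>i\<in>UNIV. \<Sum>j\<in>UNIV. ginv y i j * partial_deriv i f y * partial_deriv j \<phi> y) \<partial>lborel)"
proof -
  define w where "w i = (\<lambda>z. dens z * (\<Sum>j\<in>UNIV. ginv z i j * partial_deriv j \<phi> z))" for i
  have w: "smooth_on (w i) UNIV" for i
    unfolding w_def by (rule smooth_on_flux[OF \<phi>])
  have cw: "compactly_supported f \<or> compactly_supported (w i)" for i
    using c unfolding w_def
    by (auto intro!: compactly_supported_sum compactly_supported_mult compactly_supported_partial_deriv)
  note ibp = integral_by_parts_compact[OF f w cw]
  have "(\<integral>y. f y * lapl \<phi> y \<partial>lborel) = (\<integral>y. (\<Sum>i\<in>UNIV. f y * partial_deriv i (w i) y) \<partial>lborel)"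
    by (simp add: lapl_def w_def sum_distrib_left)
  also have "\<dots> = - (\<integral>y. (\<Sum>i\<in>UNIV. partial_deriv i f y * w i y) \<partial>lborel)"
    using ibp by (simp add: sum_negf)
  also have "(\<lambda>y. \<Sum>i\<in>UNIV. partial_deriv i f y * w i y)
    = (\<lambda>y. dens y * (\<Sum>i\<in>UNIV. \<Sum>j\<in>UNIV. ginv y i j * partial_deriv i f y * partial_deriv j \<phi> y))"
    by (simp add: w_def sum_distrib_left mult_ac)
  finally show ?thesis .
qed

lemma green:
  fixes f \<phi> :: "real ^ 'n \<Rightarrow> real"
  assumes "smooth_on f UNIV" "smooth_on \<phi> UNIV" "compactly_supported \<phi>"
  shows "(\<integral>y. f y * lapl \<phi> y \<partial>lborel) = (\<integral>y. \<phi> y * lapl f y \<partial>lborel)"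
proof -
  have "(\<Sum>i\<in>UNIV. \<Sum>j\<in>UNIV. ginv y i j * partial_deriv i f y * partial_deriv j \<phi> y)
    = (\<Sum>i\<in>UNIV. \<Sum>j\<in>UNIV. ginv y i j * partial_deriv i \<phi> y * partial_deriv j f y)" for y
    by (subst sum.swap) (simp add: ginv_commute mult_ac)
  then show ?thesis
    using assms by (simp add: green_aux)
qed

lemma lapl_integral_eq_0:
  fixes \<phi> :: "real ^ 'n \<Rightarrow> real"
  assumes "smooth_on \<phi> UNIV" "compactly_supported \<phi>"
  shows "(\<integral>y. lapl \<phi> y \<partial>lborel) = 0"
  using green[OF smooth_on_const[of 1] assms] by (simp add: lapl_const)


section \<open>The operator on radial functions\<close>

lemma partial_coshd:
  "partial_deriv i (coshd a) y = (height a / height y * y $ i - a $ i) / R\<^sup>2"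
  by (subst partial_deriv_eqI[OF coshd_has_derivative]) (simp add: inner_axis)

text \<open>These are the chart components of the gradient of \<open>coshd a\<close>. In the ambient
  space it is the tangential part of the constant vector -a / R^2, which explains why the square
  root in \<open>height y\<close> cancels.\<close>

lemma ginv_partial_coshd:
  "(\<Sum>j\<in>UNIV. ginv y i j * partial_deriv j (coshd a) y) = (coshd a y * y $ i - a $ i) / R\<^sup>2"
proof -
  have "(\<Sum>j\<in>UNIV. ginv y i j * partial_deriv j (coshd a) y)
    = (\<Sum>j\<in>UNIV. (if i = j then (height a / height y * y $ j - a $ j) / R\<^sup>2 else 0)
        + y $ i / R\<^sup>2 / R\<^sup>2 * (height a / height y * (y $ j * y $ j) - a $ j * y $ j))"
    unfolding partial_coshd ginv_def
    by (intro sum.cong refl) (simp add: field_simps)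
  also have "\<dots> = (height a / height y * y $ i - a $ i) / R\<^sup>2
      + y $ i / R\<^sup>2 / R\<^sup>2 * (height a / height y * (\<Sum>j\<in>UNIV. y $ j * y $ j) - (\<Sum>j\<in>UNIV. a $ j * y $ j))"
    by (simp only: sum.distrib sum_distrib_left[symmetric] sum_subtractf) simp
  also have "(\<Sum>j\<in>UNIV. y $ j * y $ j) = (height y)\<^sup>2 - R\<^sup>2"
    using height_sq[of y] by (simp add: power2_norm_eq_inner inner_vec_def)
  also have "(\<Sum>j\<in>UNIV. a $ j * y $ j) = height a * height y - R\<^sup>2 * coshd a y"
    using inner_eq_coshd[of a y] by (simp add: inner_vec_def)
  also have "(height a / height y * y $ i - a $ i) / R\<^sup>2 + y $ i / R\<^sup>2 / R\<^sup>2 *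
      (height a / height y * ((height y)\<^sup>2 - R\<^sup>2) - (height a * height y - R\<^sup>2 * coshd a y))
      = (coshd a y * y $ i - a $ i) / R\<^sup>2"
    by (simp add: field_simps power2_eq_square)
  finally show ?thesis .
qed

lemma dens_has_derivative: "(dens has_derivative (\<lambda>v. - dens y * (y \<bullet> v) / (height y)\<^sup>2)) (at y)"
  unfolding dens_def[abs_def]
  by (auto intro!: derivative_eq_intros height_has_derivative simp: field_simps power2_eq_square)

text \<open>The Laplacian of F(t) is F''(t) |grad t|^2 + F'(t) times the Laplacian of t, with |grad
  t|^2 = (t^2 - 1) / R^2 and Laplacian d t / R^2 of t. Radial form is asked for on an open set
  around y only, because the truncations are given by a formula in t only there.\<close>

lemma lapl_radial:
  fixes a y :: "real ^ 'n::finite"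
  assumes S: "open S" "y \<in> S" and U: "open U" "\<And>z. z \<in> S \<Longrightarrow> coshd a z \<in> U"
    and f: "\<And>z. z \<in> S \<Longrightarrow> f z = F (coshd a z)"
    and F': "\<And>t. t \<in> U \<Longrightarrow> (F has_real_derivative F' t) (at t)"
    and F'': "\<And>t. t \<in> U \<Longrightarrow> (F' has_real_derivative F'' t) (at t)"
  shows "lapl f y = dens y / R\<^sup>2 * (((coshd a y)\<^sup>2 - 1) * F'' (coshd a y)
           + CARD('n) * coshd a y * F' (coshd a y))"
proof -
  define t where "t = coshd a y"
  define A h where "A = height a" and "h = height y"
  define w where "w i = (\<lambda>z. dens z * (F' (coshd a z) * ((coshd a z * z $ i - a $ i) / R\<^sup>2)))" for i
  have pf: "partial_deriv j f z = F' (coshd a z) * partial_deriv j (coshd a) z" if "z \<in> S" for j z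
  proof -
    have "partial_deriv j f z = partial_deriv j (\<lambda>z. F (coshd a z)) z"
      using f by (rule partial_deriv_cong[OF S(1) that])
    also have "\<dots> = F' (coshd a z) * partial_deriv j (coshd a) z"
    proof -
      have "((\<lambda>z. F (coshd a z)) has_derivative
          (\<lambda>v. F' (coshd a z) * ((height a / height z * (z \<bullet> v) - a \<bullet> v) / R\<^sup>2))) (at z)"
        using has_derivative_compose[OF coshd_has_derivative[of a z],
            of F "(*) (F' (coshd a z))"] F'[OF U(2)[OF that]]
        by (simp add: has_field_derivative_def)
      then show ?thesis
        by (subst partial_deriv_eqI, assumption) (simp add: partial_coshd inner_axis)
    qed
    finally show ?thesis .
  qed
  have "dens z * (\<Sum>j\<in>UNIV. ginv z i j * partial_deriv j f z) = w i z" if "z \<in> S" for i z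
  proof -
    have "(\<Sum>j\<in>UNIV. ginv z i j * partial_deriv j f z)
      = F' (coshd a z) * (\<Sum>j\<in>UNIV. ginv z i j * partial_deriv j (coshd a) z)"
      using that by (simp add: pf sum_distrib_left mult_ac)
    then show ?thesis by (simp add: w_def ginv_partial_coshd)
  qed
  then have e1: "lapl f y = (\<Sum>i\<in>UNIV. partial_deriv i (w i) y)"
    unfolding lapl_def by (intro sum.cong refl partial_deriv_cong[OF S]) auto
  \<comment> \<open>The terms are sorted by y_i y_i, a_i y_i, a_i a_i and a term free of i, so that
    summation over i produces |y|^2, a.y, |a|^2 and the dimension.\<close>
  have pd: "partial_deriv i (w i) y =
      dens y / R\<^sup>2 * ((- F' t * t / h\<^sup>2 + F'' t * t * A / (h * R\<^sup>2) + F' t * A / (h * R\<^sup>2)) * (y $ i * y $ i)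
        + (F' t / h\<^sup>2 - F'' t * (t + A / h) / R\<^sup>2 - F' t / R\<^sup>2) * (a $ i * y $ i)
        + F'' t / R\<^sup>2 * (a $ i * a $ i) + F' t * t)" for i
  proof -
    have c: "(coshd a has_derivative (\<lambda>v. (A / h * (y \<bullet> v) - a \<bullet> v) / R\<^sup>2)) (at y)"
      using coshd_has_derivative[of a y] by (simp add: A_def h_def)
    have F'c: "((\<lambda>z. F' (coshd a z)) has_derivative (\<lambda>v. F'' t * ((A / h * (y \<bullet> v) - a \<bullet> v) / R\<^sup>2))) (at y)"
      using has_derivative_compose[OF c, of F' "(*) (F'' t)"] F''[OF U(2)[OF S(2)]]
      by (simp add: has_field_derivative_def t_def)
    have l: "((\<lambda>z. (coshd a z * z $ i - a $ i) / R\<^sup>2) has_derivative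
        (\<lambda>v. (t * v $ i + ((A / h * (y \<bullet> v) - a \<bullet> v) / R\<^sup>2) * y $ i) / R\<^sup>2)) (at y)"
      by (auto intro!: derivative_eq_intros c bounded_linear_imp_has_derivative[OF bounded_linear_vec_nth]
          simp: t_def field_simps)
    have "(w i has_derivative (\<lambda>v. dens y * (F' t * ((t * v $ i + ((A / h * (y \<bullet> v) - a \<bullet> v) / R\<^sup>2) * y $ i) / R\<^sup>2)
           + F'' t * ((A / h * (y \<bullet> v) - a \<bullet> v) / R\<^sup>2) * ((t * y $ i - a $ i) / R\<^sup>2))
         + (- dens y * (y \<bullet> v) / (height y)\<^sup>2) * (F' t * ((t * y $ i - a $ i) / R\<^sup>2)))) (at y)"
      using has_derivative_mult[OF dens_has_derivative[of y] has_derivative_mult[OF F'c l]]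
      by (simp add: w_def t_def)
    then have "partial_deriv i (w i) y = dens y * (F' t * ((t + ((A / h * y $ i - a $ i) / R\<^sup>2) * y $ i) / R\<^sup>2)
           + F'' t * ((A / h * y $ i - a $ i) / R\<^sup>2) * ((t * y $ i - a $ i) / R\<^sup>2))
         + (- dens y * y $ i / h\<^sup>2) * (F' t * ((t * y $ i - a $ i) / R\<^sup>2))"
      by (subst partial_deriv_eqI, assumption) (simp add: inner_axis h_def)
    also have "\<dots> = dens y / R\<^sup>2 * ((- F' t * t / h\<^sup>2 + F'' t * t * A / (h * R\<^sup>2) + F' t * A / (h * R\<^sup>2)) * (y $ i * y $ i)
        + (F' t / h\<^sup>2 - F'' t * (t + A / h) / R\<^sup>2 - F' t / R\<^sup>2) * (a $ i * y $ i)
        + F'' t / R\<^sup>2 * (a $ i * a $ i) + F' t * t)"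
      using height_nonzero[of y] unfolding h_def[symmetric] by (simp add: field_simps power2_eq_square)
    finally show ?thesis .
  qed
  have "lapl f y = (\<Sum>i\<in>UNIV. dens y / R\<^sup>2 * ((- F' t * t / h\<^sup>2 + F'' t * t * A / (h * R\<^sup>2) + F' t * A / (h * R\<^sup>2)) * (y $ i * y $ i)
        + (F' t / h\<^sup>2 - F'' t * (t + A / h) / R\<^sup>2 - F' t / R\<^sup>2) * (a $ i * y $ i)
        + F'' t / R\<^sup>2 * (a $ i * a $ i) + F' t * t))"
    unfolding e1 by (intro sum.cong refl pd)
  also have "\<dots> = dens y / R\<^sup>2 * ((- F' t * t / h\<^sup>2 + F'' t * t * A / (h * R\<^sup>2) + F' t * A / (h * R\<^sup>2)) * (\<Sum>i\<in>UNIV. y $ i * y $ i)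
        + (F' t / h\<^sup>2 - F'' t * (t + A / h) / R\<^sup>2 - F' t / R\<^sup>2) * (\<Sum>i\<in>UNIV. a $ i * y $ i)
        + F'' t / R\<^sup>2 * (\<Sum>i\<in>UNIV. a $ i * a $ i) + CARD('n) * (F' t * t))"
    by (simp only: sum_distrib_left[symmetric] sum.distrib sum_constant of_nat_mult)
      (simp only: mult_ac)
  also have "(\<Sum>i\<in>UNIV. y $ i * y $ i) = h\<^sup>2 - R\<^sup>2"
    using height_sq[of y] by (simp add: power2_norm_eq_inner inner_vec_def h_def)
  also have "(\<Sum>i\<in>UNIV. a $ i * y $ i) = A * h - R\<^sup>2 * t"
    using inner_eq_coshd[of a y] by (simp add: inner_vec_def A_def h_def t_def)
  also have "(\<Sum>i\<in>UNIV. a $ i * a $ i) = A\<^sup>2 - R\<^sup>2"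
    using height_sq[of a] by (simp add: power2_norm_eq_inner inner_vec_def A_def)
  also have "(- F' t * t / h\<^sup>2 + F'' t * t * A / (h * R\<^sup>2) + F' t * A / (h * R\<^sup>2)) * (h\<^sup>2 - R\<^sup>2)
        + (F' t / h\<^sup>2 - F'' t * (t + A / h) / R\<^sup>2 - F' t / R\<^sup>2) * (A * h - R\<^sup>2 * t)
        + F'' t / R\<^sup>2 * (A\<^sup>2 - R\<^sup>2) + CARD('n) * (F' t * t)
      = (t\<^sup>2 - 1) * F'' t + CARD('n) * t * F' t"
    using height_nonzero[of y] unfolding h_def[symmetric] by (simp add: field_simps power2_eq_square)
  finally show ?thesis by (simp add: t_def)
qed

end

section \<open>The radial profile\<close>

text \<open>A smooth concave substitute for the minimum with a constant: the slope is 1 up to s = 1,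
  decreases on [1, 2] and is 0 afterwards.\<close>

definition cutoff :: "real \<Rightarrow> real" where
  "cutoff s = integral {0..s} (\<lambda>x. 1 - smooth_step (x - 1))"

lemma continuous_on_smooth_step_shift: "continuous_on S (\<lambda>x. 1 - smooth_step (x - 1))"
  by (intro continuous_intros continuous_on_compose2[OF smooth_on_imp_continuous_on[OF smooth_on_smooth_step]])
    auto

lemma cutoff_deriv: "s > 0 \<Longrightarrow> (cutoff has_real_derivative 1 - smooth_step (s - 1)) (at s)"
proof -
  assume s: "s > 0"
  have "((\<lambda>s. integral {0..s} (\<lambda>x. 1 - smooth_step (x - 1))) has_real_derivative
      1 - smooth_step (s - 1)) (at s within {0..s + 1})"
    using s by (intro integral_has_real_derivative continuous_on_smooth_step_shift) auto
  then show ?thesis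
    using s at_within_interior[of s "{0..s + 1}"] by (simp add: cutoff_def[abs_def])
qed

lemma smooth_step_shift_deriv:
  "((\<lambda>s. 1 - smooth_step (s - 1)) has_real_derivative - deriv smooth_step (s - 1)) (at s)"
  by (auto intro!: derivative_eq_intros DERIV_chain2[OF smooth_step_deriv])

lemma smooth_on_smooth_step_shift: "smooth_on (\<lambda>s. 1 - smooth_step (s - 1)) UNIV"
  by (intro smooth_on_diff smooth_on_const smooth_on_compose[OF _ _ smooth_on_smooth_step]
      smooth_on_linear bounded_linear_ident) auto

lemma smooth_on_cutoff: "smooth_on cutoff {0<..}"
  by (rule smooth_onI_real[OF _ cutoff_deriv])
    (auto intro: smooth_on_subset[OF smooth_on_smooth_step_shift])

lemma cutoff_eq: "0 \<le> s \<Longrightarrow> s \<le> 1 \<Longrightarrow> cutoff s = s"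
proof -
  assume s: "0 \<le> s" "s \<le> 1"
  have "cutoff s = integral {0..s} (\<lambda>x. 1)"
    unfolding cutoff_def using s by (intro integral_cong) (auto simp: smooth_step_eq_0)
  then show ?thesis using s by simp
qed

lemma cutoff_const:
  assumes "s \<ge> 2"
  shows "cutoff s = cutoff 2"
proof -
  have "cutoff 2 + integral {2..s} (\<lambda>x. 1 - smooth_step (x - 1)) = cutoff s"
    unfolding cutoff_def using assms
    by (intro Henstock_Kurzweil_Integration.integral_combine integrable_continuous_real
        continuous_on_smooth_step_shift) auto
  moreover have "integral {2..s} (\<lambda>x. 1 - smooth_step (x - 1)) = integral {2..s} (\<lambda>x. 0)"
    by (intro integral_cong) (auto simp: smooth_step_eq_1)
  ultimately show ?thesis by simp
qed

lemma cutoff_bounds: "0 \<le> s \<Longrightarrow> 0 \<le> cutoff s" "0 \<le> s \<Longrightarrow> cutoff s \<le> s"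
proof -
  show "0 \<le> cutoff s" unfolding cutoff_def
    using smooth_step_bounds by (intro integral_nonneg integrable_continuous_real
        continuous_on_smooth_step_shift) auto
  assume "0 \<le> s"
  have "cutoff s \<le> integral {0..s} (\<lambda>x. 1)" unfolding cutoff_def
    using smooth_step_bounds by (intro integral_le integrable_continuous_real
        continuous_on_smooth_step_shift continuous_on_const) auto
  then show "cutoff s \<le> s" using \<open>0 \<le> s\<close> by simp
qed

text \<open>The substitution \<open>w = 1 / s\<close> turns \<open>\<integral>\<^sub>t\<^sup>\<infinity> (s\<^sup>2 - 1)\<^bsup>-d/2\<^esup> ds\<close> into an integral over
  \<open>[0, 1 / t]\<close> of a continuous function.\<close>

definition profile :: "nat \<Rightarrow> real \<Rightarrow> real" where
  "profile d t = integral {0..1 / t} (\<lambda>w. w ^ (d - 2) * (1 - w\<^sup>2) powr (- real d / 2))"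

lemma profile_integrand_continuous:
  "b < 1 \<Longrightarrow> continuous_on {0..b::real} (\<lambda>w. w ^ (d - 2) * (1 - w\<^sup>2) powr (- real d / 2))"
  by (intro continuous_intros) (auto simp: power2_eq_square, metis abs_square_eq_1 abs_of_nonneg
      less_eq_real_def linorder_not_less power2_eq_square)

lemma profile_deriv:
  assumes "t > 1" "d \<ge> 2"
  shows "(profile d has_real_derivative - ((t\<^sup>2 - 1) powr (- real d / 2))) (at t)"
proof -
  define g where "g = (\<lambda>w::real. w ^ (d - 2) * (1 - w\<^sup>2) powr (- real d / 2))"
  \<comment> \<open>The midpoint of 1 / t and 1: 1 / t is then interior to [0, b], and the integrand
    is continuous up to b.\<close>
  define b where "b = (1 + 1 / t) / 2"
  have b: "1 / t < b" "b < 1" using assms by (auto simp: b_def field_simps)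
  have "((\<lambda>v. integral {0..v} g) has_real_derivative g (1 / t)) (at (1 / t) within {0..b})"
    unfolding g_def using b assms
    by (intro integral_has_real_derivative profile_integrand_continuous) auto
  then have W: "((\<lambda>v. integral {0..v} g) has_real_derivative g (1 / t)) (at (1 / t))"
    using b assms at_within_interior[of "1 / t" "{0..b}"] by simp
  have "((\<lambda>t. 1 / t) has_real_derivative - (1 / t\<^sup>2)) (at t)"
    using assms by (auto intro!: derivative_eq_intros simp: power2_eq_square)
  then have "((\<lambda>t. integral {0..1 / t} g) has_real_derivative g (1 / t) * - (1 / t\<^sup>2)) (at t)"
    by (rule DERIV_chain2[where f = "\<lambda>v. integral {0..v} g" and g = "\<lambda>t. 1 / t", OF W])
  moreover have "g (1 / t) * - (1 / t\<^sup>2) = - ((t\<^sup>2 - 1) powr (- real d / 2))"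
  proof -
    have "1 - (1 / t)\<^sup>2 = (t\<^sup>2 - 1) / t\<^sup>2" using assms by (simp add: field_simps)
    moreover have "(t\<^sup>2) powr (- real d / 2) = 1 / t ^ d"
      using assms by (simp add: powr_minus powr_powr powr_realpow[symmetric] field_simps flip: powr_numeral)
    ultimately have "(1 - (1 / t)\<^sup>2) powr (- real d / 2) = (t\<^sup>2 - 1) powr (- real d / 2) * t ^ d"
      using assms by (simp add: powr_divide)
    moreover have "t ^ d = t ^ (d - 2) * t\<^sup>2"
      by (metis assms(2) le_add_diff_inverse2 power_add)
    ultimately show ?thesis
      using assms by (simp add: g_def power_divide)
  qed
  ultimately show ?thesis by (simp add: profile_def[abs_def] g_def)
qed

lemma profile_deriv2:
  assumes "t > 1"
  shows "((\<lambda>t. - ((t\<^sup>2 - 1) powr (- real d / 2))) has_real_derivative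
    real d * t * (t\<^sup>2 - 1) powr (- real d / 2 - 1)) (at t)"
  using assms by (auto intro!: derivative_eq_intros simp: field_simps)

text \<open>The bracket in \<open>lapl_radial\<close> for F = \<open>profile d\<close>, so this is
  the harmonicity of G off its pole.\<close>

lemma profile_ode:
  "(t::real) > 1 \<Longrightarrow> (t\<^sup>2 - 1) * (real d * t * (t\<^sup>2 - 1) powr (- real d / 2 - 1))
      + d * t * - ((t\<^sup>2 - 1) powr (- real d / 2)) = 0"
  by (simp add: powr_diff)

lemma smooth_on_profile:
  assumes "d \<ge> 2"
  shows "smooth_on (profile d) {1<..}"
proof (rule smooth_onI_real[OF _ profile_deriv])
  have "smooth_on (\<lambda>t::real. t * t - 1) {1<..}"
    by (intro smooth_on_diff smooth_on_mult smooth_on_linear smooth_on_const) auto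
  then have "smooth_on (\<lambda>t::real. (t * t - 1) powr (- real d / 2)) {1<..}"
    by (intro smooth_on_compose[where g = "\<lambda>x. x powr (- real d / 2)", OF _ _ smooth_on_powr])
      (auto simp: less_1_mult)
  then show "smooth_on (\<lambda>t::real. - ((t\<^sup>2 - 1) powr (- real d / 2))) {1<..}"
    by (intro smooth_on_minus) (auto simp: power2_eq_square)
qed (use assms in auto)

lemma profile_less:
  assumes "1 < s" "s < t" "d \<ge> 2"
  shows "profile d t < profile d s"
proof (rule DERIV_neg_imp_decreasing[OF assms(2)])
  fix x assume "s \<le> x" "x \<le> t"
  then have "x > 1" using assms by simp
  then have "x\<^sup>2 - 1 > 0" by (simp add: power2_eq_square less_1_mult)
  then have "(x\<^sup>2 - 1) powr (- real d / 2) > 0" by (metis less_irrefl powr_gt_zero)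
  then show "\<exists>y. (profile d has_real_derivative y) (at x) \<and> y < 0"
    using profile_deriv[OF \<open>x > 1\<close> assms(3)]
    by (intro exI[of _ "- ((x\<^sup>2 - 1) powr (- real d / 2))"] conjI) auto
qed

lemma profile_nonneg: "t > 1 \<Longrightarrow> profile d t \<ge> 0"
  unfolding profile_def
  by (intro integral_nonneg integrable_continuous_real profile_integrand_continuous) auto

lemma profile_pos: "t > 1 \<Longrightarrow> d \<ge> 2 \<Longrightarrow> profile d t > 0"
  using profile_less[of t "t + 1" d] profile_nonneg[of "t + 1" d] by simp

text \<open>Because the upper limit of integration is 1 / t, decay at infinity is continuity of the
  indefinite integral at 0.\<close>

lemma profile_tendsto_0:
  assumes "\<epsilon> > 0"
  shows "\<exists>T>1. \<forall>t\<ge>T. profile d t < \<epsilon>"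
proof -
  define g where "g = (\<lambda>w::real. w ^ (d - 2) * (1 - w\<^sup>2) powr (- real d / 2))"
  have "g integrable_on {0..1/2}"
    unfolding g_def by (intro integrable_continuous_real profile_integrand_continuous) auto
  then have "continuous_on {0..1/2} (\<lambda>v. integral {0..v} g)"
    by (rule indefinite_integral_continuous_1)
  then obtain \<delta> where \<delta>: "\<delta> > 0" "\<And>v. v \<in> {0..1/2} \<Longrightarrow> dist v 0 < \<delta> \<Longrightarrow> dist (integral {0..v} g) (integral {0..0} g) < \<epsilon>"
    using assms unfolding continuous_on_iff by (metis atLeastAtMost_iff divide_nonneg_nonneg order_refl zero_le_numeral zero_le_one)
  have "profile d t < \<epsilon>" if t: "t \<ge> max 2 (2 / \<delta>)" for t
  proof -
    have "1 / t \<in> {0..1/2}" using t by (auto simp: field_simps)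
    moreover have "1 / t < \<delta>" using t \<delta>(1) by (auto simp: field_simps)
    ultimately show ?thesis
      using \<delta>(2)[of "1 / t"] t by (simp add: profile_def g_def dist_real_def)
  qed
  then show ?thesis by (intro exI[of _ "max 2 (2 / \<delta>)"]) auto
qed

text \<open>On (1, 5/4] one has t^2 - 1 <= 1 and t + 1 <= 3, so with d >= 2 the slope of the profile
  is at most -1 / (3 (t - 1)). Thus the profile dominates -ln (t - 1) / 3 up to a constant; for d =
  2 the growth really is logarithmic.\<close>

lemma profile_blowup:
  assumes "d \<ge> 2"
  shows "\<exists>t0>1. \<forall>t. 1 < t \<and> t < t0 \<longrightarrow> profile d t > M"
proof -
  define L where "L t = profile d t + ln (t - 1) / 3" for t
  have dec: "L t \<ge> L (5/4)" if t: "1 < t" "t \<le> 5/4" for t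
  proof (rule DERIV_nonpos_imp_nonincreasing[OF t(2)])
    fix x assume "t \<le> x" "x \<le> 5/4"
    then have x: "1 < x" "x \<le> 5/4" using t by auto
    have pos: "0 < x\<^sup>2 - 1" using x by (simp add: power2_eq_square less_1_mult)
    have "x\<^sup>2 \<le> (5/4)\<^sup>2" using x by (intro power_mono) auto
    then have le1: "x\<^sup>2 - 1 \<le> 1" by (simp add: power2_eq_square)
    have "1 / (3 * (x - 1)) \<le> 1 / (x\<^sup>2 - 1)"
    proof (rule divide_left_mono)
      have "x\<^sup>2 - 1 = (x + 1) * (x - 1)" by (simp add: algebra_simps power2_eq_square)
      also have "\<dots> \<le> 3 * (x - 1)" using x by (intro mult_right_mono) auto
      finally show "x\<^sup>2 - 1 \<le> 3 * (x - 1)" .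
    qed (use x pos in auto)
    also have "1 / (x\<^sup>2 - 1) = (x\<^sup>2 - 1) powr (-1)"
      using pos by (simp add: powr_minus divide_inverse)
    also have "\<dots> \<le> (x\<^sup>2 - 1) powr (- real d / 2)"
      using pos le1 assms by (intro powr_mono') auto
    finally have "- ((x\<^sup>2 - 1) powr (- real d / 2)) + 1 / (3 * (x - 1)) \<le> 0" by simp
    moreover have "(L has_real_derivative - ((x\<^sup>2 - 1) powr (- real d / 2)) + 1 / (3 * (x - 1))) (at x)"
      unfolding L_def using x assms by (auto intro!: derivative_eq_intros profile_deriv simp: field_simps)
    ultimately show "\<exists>y. (L has_real_derivative y) (at x) \<and> y \<le> 0" by blast
  qed
  \<comment> \<open>The exponential solves ln \<tau> = 3 (L (5/4) - M); the minimum keeps t in the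
    range of \<open>dec\<close>.\<close>
  define \<tau> where "\<tau> = min (1/4) (exp (3 * (L (5/4) - M)))"
  have "profile d t > M" if t: "1 < t" "t < 1 + \<tau>" for t
  proof -
    have "t \<le> 5/4" "t - 1 < exp (3 * (L (5/4) - M))" using t by (auto simp: \<tau>_def)
    then have "ln (t - 1) < 3 * (L (5/4) - M)"
      using t ln_less_cancel_iff[of "t - 1" "exp (3 * (L (5/4) - M))"] by simp
    then show ?thesis using dec[of t] t \<open>t \<le> 5/4\<close> by (simp add: L_def)
  qed
  moreover have "1 + \<tau> > 1" by (simp add: \<tau>_def)
  ultimately show ?thesis by blast
qed

section \<open>Truncated fundamental solutions\<close>

text \<open>The \<open>itself\<close> parameter fixes the type of the coordinates, so that the bound
  on the dimension can be a locale assumption.\<close>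

locale hyperbolic_green = hyperbolic_chart R for R :: real +
  fixes dim_type :: "'n::finite itself"
  assumes dim_ge_2: "CARD('n) \<ge> 2"
begin

definition G :: "real ^ 'n \<Rightarrow> real ^ 'n \<Rightarrow> real" where
  "G a y = profile CARD('n) (coshd a y)"

text \<open>Rescaling \<open>cutoff\<close> by p keeps G up to level p and gives the constant
  \<open>p * cutoff 2\<close> from level 2 p on. \<open>G a a\<close> carries no meaning, so the
  pole receives that constant explicitly, which makes the function smooth across it.\<close>

definition gcut :: "real \<Rightarrow> real ^ 'n \<Rightarrow> real ^ 'n \<Rightarrow> real" where
  "gcut p a y = (if y = a then p * cutoff 2 else p * cutoff (G a y / p))"

text \<open>Since \<open>lapl\<close> contains the volume density, this is a density with respect to
  \<open>lborel\<close>.\<close>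

definition gker :: "real \<Rightarrow> real ^ 'n \<Rightarrow> real ^ 'n \<Rightarrow> real" where
  "gker p a y = - lapl (gcut p a) y"

lemma G_commute: "G a y = G y a"
  by (simp add: G_def coshd_commute)

lemma G_pos: "y \<noteq> a \<Longrightarrow> G a y > 0"
  using profile_pos[OF coshd_gt_1 dim_ge_2] by (auto simp: G_def)

lemma smooth_on_G: "smooth_on (G a) (- {a})"
  unfolding G_def[abs_def]
  by (rule smooth_on_compose[where g = "profile CARD('n)",
        OF _ smooth_on_subset[OF smooth_on_coshd] smooth_on_profile[OF dim_ge_2]])
    (auto intro: coshd_gt_1)

lemma continuous_on_G: "continuous_on (- {a}) (G a)"
  by (rule smooth_on_imp_continuous_on[OF smooth_on_G])

lemma G_far:
  assumes "\<epsilon> > 0"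
  shows "\<exists>r. \<forall>y. norm y > r \<longrightarrow> G a y < \<epsilon>"
proof -
  obtain T where T: "T > 1" "\<And>t. t \<ge> T \<Longrightarrow> profile CARD('n) t < \<epsilon>"
    using profile_tendsto_0[OF assms] by blast
  have "G a y < \<epsilon>" if "norm y > 2 * height a * T" for y
  proof -
    have "2 * height a * T < 2 * height a * coshd a y"
      using that height_ge(2)[of y] coshd_lower[of y a] by linarith
    then have "T \<le> coshd a y" using height_pos[of a] by simp
    then show ?thesis unfolding G_def by (rule T(2))
  qed
  then show ?thesis by blast
qed

lemma G_near:
  shows "\<exists>r>0. \<forall>y. y \<noteq> a \<and> norm (y - a) < r \<longrightarrow> G a y > M"
proof -
  obtain t0 where t0: "t0 > 1" "\<And>t. 1 < t \<Longrightarrow> t < t0 \<Longrightarrow> profile CARD('n) t > M"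
    using profile_blowup[OF dim_ge_2] by blast
  have "open {y. coshd a y < t0}"
    by (intro open_Collect_less continuous_on_coshd continuous_intros)
  moreover have "a \<in> {y. coshd a y < t0}" using t0 by (simp add: coshd_self)
  ultimately obtain r where r: "r > 0" "ball a r \<subseteq> {y. coshd a y < t0}"
    using open_contains_ball by blast
  have "G a y > M" if "y \<noteq> a" "norm (y - a) < r" for y
    unfolding G_def using that r(2) coshd_gt_1[of y a]
    by (intro t0(2)) (auto simp: dist_norm norm_minus_commute)
  then show ?thesis using r(1) by blast
qed

text \<open>The shell that carries \<open>gker p a\<close> lies in any prescribed ball around a once
  p is large; \<open>G_small_imp_far\<close> is the counterpart for small p.\<close>

lemma G_large_imp_near:
  assumes "r > 0"
  shows "\<exists>M>0. \<forall>y. y \<noteq> a \<and> G a y > M \<longrightarrow> norm (y - a) < r"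
proof -
  obtain t0 where t0: "t0 > 1" "\<And>y. coshd a y \<le> t0 \<Longrightarrow> norm (a - y) < r"
    using coshd_concentrated[OF assms] by blast
  have "norm (y - a) < r" if "y \<noteq> a" "G a y > profile CARD('n) t0" for y
  proof -
    have "coshd a y \<le> t0"
      using profile_less[OF t0(1) _ dim_ge_2, of "coshd a y"] that by (force simp: G_def)
    then show ?thesis using t0(2)[of y] by (simp add: norm_minus_commute)
  qed
  then show ?thesis using profile_pos[OF t0(1) dim_ge_2] by blast
qed

lemma G_small_imp_far: "\<exists>\<epsilon>>0. \<forall>y. y \<noteq> a \<and> G a y < \<epsilon> \<longrightarrow> norm y > r"
proof -
  \<comment> \<open>By \<open>coshd_upper\<close>, points of norm at most r satisfy coshd a y <= T.
    The maximum with 2 keeps T above 1, where the profile decreases.\<close>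
  define T where "T = max 2 (2 * height a * (R + max r 0) / R\<^sup>2)"
  have T: "T > 1" by (simp add: T_def)
  have "norm y > r" if y: "y \<noteq> a" "G a y < profile CARD('n) T" for y
  proof (rule ccontr)
    assume n: "\<not> norm y > r"
    have "height y \<le> R + max r 0" using height_le[of y] n by linarith
    then have "R\<^sup>2 * coshd a y \<le> 2 * height a * (R + max r 0)"
      using coshd_upper[of a y] mult_left_mono[of "height y" "R + max r 0" "height a"] height_pos[of a]
      by linarith
    then have "coshd a y \<le> 2 * height a * (R + max r 0) / R\<^sup>2"
      using R_pos by (simp add: pos_le_divide_eq mult.commute)
    then have "coshd a y \<le> T" by (simp add: T_def)
    then have "profile CARD('n) T \<le> G a y"
      using profile_less[OF coshd_gt_1[of y a] _ dim_ge_2, of T] y(1)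
      by (cases "coshd a y = T") (auto simp: G_def less_imp_le)
    then show False using y(2) by simp
  qed
  then show ?thesis using profile_pos[OF T dim_ge_2] by blast
qed

context
  fixes p :: real
  assumes p_pos: "p > 0"
begin

lemma gcut_nonneg: "gcut p a y \<ge> 0"
  using p_pos G_pos[of y a] cutoff_bounds(1)[of 2] cutoff_bounds(1)[of "G a y / p"]
  by (cases "y = a") (auto simp: gcut_def)

lemma gcut_le_G: "y \<noteq> a \<Longrightarrow> gcut p a y \<le> G a y"
  using p_pos G_pos[of y a] cutoff_bounds(2)[of "G a y / p"]
  by (simp add: gcut_def field_simps)

lemma gcut_eq_G: "y \<noteq> a \<Longrightarrow> G a y \<le> p \<Longrightarrow> gcut p a y = G a y"
  using p_pos G_pos[of y a] by (simp add: gcut_def cutoff_eq)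

lemma gcut_eq_const: "y = a \<or> G a y \<ge> 2 * p \<Longrightarrow> gcut p a y = p * cutoff 2"
  using p_pos cutoff_const[of "G a y / p"] by (auto simp: gcut_def field_simps)

lemma gcut_le: "gcut p a y \<le> 2 * p"
proof (cases "y = a \<or> G a y \<ge> 2 * p")
  case True
  then show ?thesis using gcut_eq_const[OF True] cutoff_bounds(2)[of 2] p_pos by simp
next
  case False
  then show ?thesis using gcut_le_G[of y a] by simp
qed

lemma gcut_near: "\<exists>r>0. \<forall>y\<in>ball a r. gcut p a y = p * cutoff 2"
proof -
  obtain r where r: "r > 0" "\<And>y. y \<noteq> a \<Longrightarrow> norm (y - a) < r \<Longrightarrow> G a y > 2 * p"
    using G_near by blast
  have "gcut p a y = p * cutoff 2" if "y \<in> ball a r" for y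
    using r(2)[of y] that
    by (intro gcut_eq_const) (force simp: dist_norm norm_minus_commute)
  then show ?thesis using r(1) by blast
qed

lemma smooth_on_gcut: "smooth_on (gcut p a) UNIV"
proof -
  obtain r where r: "r > 0" "\<And>y. y \<in> ball a r \<Longrightarrow> gcut p a y = p * cutoff 2"
    using gcut_near by blast
  have 1: "smooth_on (gcut p a) (ball a r)"
    by (rule smooth_on_cong[OF open_ball _ smooth_on_const]) (use r in auto)
  have "smooth_on (\<lambda>y. G a y * (1 / p)) (- {a})"
    by (intro smooth_on_mult smooth_on_G smooth_on_const) auto
  then have "smooth_on (\<lambda>y. cutoff (G a y * (1 / p))) (- {a})"
    by (rule smooth_on_compose[where g = cutoff, OF _ _ smooth_on_cutoff, rotated])
      (use p_pos in \<open>auto intro!: divide_pos_pos G_pos\<close>)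
  then have "smooth_on (\<lambda>y. p * cutoff (G a y * (1 / p))) (- {a})"
    by (intro smooth_on_mult smooth_on_const) auto
  then have 2: "smooth_on (gcut p a) (- {a})"
    by (rule smooth_on_cong[rotated 2]) (auto simp: gcut_def)
  have "ball a r \<union> - {a} = UNIV" using r(1) by auto
  then show ?thesis using smooth_on_Un[OF open_ball open_Compl[OF closed_singleton] 1 2] by simp
qed

text \<open>The terms with the derivatives of the profile alone cancel by
  \<open>profile_ode\<close>. What remains is dens y times |grad G|^2 times the negative of the
  second derivative of \<open>cutoff\<close> at G / p, divided by p. Sign and support of the kernel
  can be read off.\<close>

lemma gker_eq:
  assumes "y \<noteq> a"
  defines "t \<equiv> coshd a y"
  shows "gker p a y = dens y / R\<^sup>2 * (t\<^sup>2 - 1) * ((t\<^sup>2 - 1) powr (- real CARD('n) / 2))\<^sup>2 / p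
    * deriv smooth_step (G a y / p - 1)"
proof -
  define d where "d = CARD('n)"
  define P' where "P' t = - ((t\<^sup>2 - 1) powr (- real d / 2))" for t :: real
  define P'' where "P'' t = real d * t * (t\<^sup>2 - 1) powr (- real d / 2 - 1)" for t :: real
  define F where "F t = p * cutoff (profile d t / p)" for t
  define F' where "F' t = (1 - smooth_step (profile d t / p - 1)) * P' t" for t
  define F'' where "F'' t = (1 - smooth_step (profile d t / p - 1)) * P'' t
      + (- deriv smooth_step (profile d t / p - 1) * (P' t / p)) * P' t" for t
  have d: "d \<ge> 2" using dim_ge_2 by (simp add: d_def)
  have DP: "((\<lambda>t. profile d t / p) has_real_derivative P' t / p) (at t)" if "t > 1" for t
    using profile_deriv[OF that d] unfolding P'_def by (rule DERIV_cdivide)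
  have DF: "(F has_real_derivative F' t) (at t)" if "t > 1" for t
  proof -
    have "profile d t / p > 0" using profile_pos[OF that d] p_pos by simp
    from DERIV_cmult[OF DERIV_chain2[where f = cutoff, OF cutoff_deriv[OF this] DP[OF that]], of p]
    show ?thesis using p_pos by (simp add: F_def[abs_def] F'_def)
  qed
  have DF': "(F' has_real_derivative F'' t) (at t)" if "t > 1" for t
  proof -
    have "((\<lambda>t. 1 - smooth_step (profile d t / p - 1)) has_real_derivative
        - deriv smooth_step (profile d t / p - 1) * (P' t / p)) (at t)"
      by (rule DERIV_chain2[where f = "\<lambda>s. 1 - smooth_step (s - 1)",
            OF smooth_step_shift_deriv DP[OF that]])
    moreover have "(P' has_real_derivative P'' t) (at t)"
      unfolding P'_def[abs_def] P''_def by (rule profile_deriv2[OF that])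
    ultimately have "((\<lambda>t. (1 - smooth_step (profile d t / p - 1)) * P' t) has_real_derivative
        (- deriv smooth_step (profile d t / p - 1) * (P' t / p)) * P' t
          + P'' t * (1 - smooth_step (profile d t / p - 1))) (at t)"
      by (rule DERIV_mult)
    then show ?thesis by (simp add: F'_def[abs_def] F''_def add.commute mult.commute)
  qed
  have t: "t > 1" using assms coshd_gt_1[of y a] by auto
  have "lapl (gcut p a) y = dens y / R\<^sup>2 * (((coshd a y)\<^sup>2 - 1) * F'' (coshd a y)
           + CARD('n) * coshd a y * F' (coshd a y))"
    by (rule lapl_radial[of "- {a}" _ "{1<..}" _ _ F])
      (use assms(1) DF DF' in \<open>auto simp: gcut_def F_def G_def d_def coshd_gt_1\<close>)
  also have "\<dots> = dens y / R\<^sup>2 * ((1 - smooth_step (profile d t / p - 1)) * ((t\<^sup>2 - 1) * P'' t + d * t * P' t)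
       - (t\<^sup>2 - 1) * deriv smooth_step (profile d t / p - 1) * (P' t)\<^sup>2 / p)"
    by (simp add: F'_def F''_def t_def d_def algebra_simps power2_eq_square)
  also have "(t\<^sup>2 - 1) * P'' t + d * t * P' t = 0"
    unfolding P'_def P''_def by (rule profile_ode[OF t])
  finally show ?thesis
    by (simp add: gker_def G_def P'_def d_def t_def)
qed

lemma gker_self: "gker p a a = 0"
proof -
  obtain r where r: "r > 0" "\<And>y. y \<in> ball a r \<Longrightarrow> gcut p a y = p * cutoff 2"
    using gcut_near by blast
  have "lapl (gcut p a) a = lapl (\<lambda>y. p * cutoff 2) a"
    by (rule lapl_cong[OF open_ball[of a r]]) (use r in auto)
  then show ?thesis by (simp add: gker_def lapl_const)
qed

lemma gker_nonneg: "gker p a y \<ge> 0"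
proof (cases "y = a")
  case False
  have "(coshd a y)\<^sup>2 - 1 \<ge> 0" using coshd_ge_1[of a y] by simp
  then show ?thesis
    using dens_pos[of y] p_pos deriv_smooth_step_nonneg unfolding gker_eq[OF False]
    by (intro mult_nonneg_nonneg divide_nonneg_nonneg) (auto simp: less_imp_le)
qed (simp add: gker_self)

lemma gker_nonzeroD:
  assumes "gker p a y \<noteq> 0"
  shows "y \<noteq> a" "p < G a y" "G a y < 2 * p"
proof -
  show "y \<noteq> a" using assms gker_self by auto
  then have "deriv smooth_step (G a y / p - 1) \<noteq> 0"
    using assms gker_eq[of y a] by auto
  then have "\<not> (G a y / p - 1 \<le> 0 \<or> 1 \<le> G a y / p - 1)"
    using deriv_smooth_step_eq_0 by blast
  then show "p < G a y" "G a y < 2 * p"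
    using p_pos by (auto simp: field_simps not_le)
qed

lemma smooth_on_gker: "smooth_on (gker p a) UNIV"
  unfolding gker_def[abs_def] by (intro smooth_on_minus smooth_on_lapl smooth_on_gcut) auto

lemma continuous_on_gker: "continuous_on UNIV (gker p a)"
  by (rule smooth_on_imp_continuous_on[OF smooth_on_gker])

lemma compactly_supported_gker: "compactly_supported (gker p a)"
proof -
  obtain r where "\<And>y. norm y > r \<Longrightarrow> G a y < p" using G_far[OF p_pos] by blast
  then show ?thesis unfolding compactly_supported_def
    using gker_nonzeroD(2) by (meson not_less_iff_gr_or_eq)
qed

lemma integrable_gker: "integrable lborel (gker p a)"
  by (rule integrable_compactly_supported[OF continuous_on_gker compactly_supported_gker])

text \<open>The step climbs from 0 to 1, so its derivative is 1 at some z in (0, 1). The level p (1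
  + z) is attained by G, because the punctured space is connected in dimension at least 2 and G
  takes larger values near the pole and smaller ones far out.\<close>

lemma gker_pos_ex: "\<exists>y. gker p a y > 0"
proof -
  have "\<exists>z>0. z < 1 \<and> smooth_step 1 - smooth_step 0 = (1 - 0) * deriv smooth_step z"
    by (rule MVT2) (auto simp: smooth_step_deriv)
  then obtain z where z: "0 < z" "z < 1" "deriv smooth_step z = 1"
    by (auto simp: smooth_step_eq_0 smooth_step_eq_1)
  have conn: "connected (G a ` (- {a}))"
    using dim_ge_2 continuous_on_G
    by (intro connected_continuous_image connected_punctured_universe) auto
  obtain y1 where y1: "y1 \<noteq> a" "p * (1 + z) < G a y1"
  proof -
    obtain r where r: "r > 0" "\<And>y. y \<noteq> a \<Longrightarrow> norm (y - a) < r \<Longrightarrow> G a y > p * (1 + z)"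
      using G_near by blast
    show thesis
      by (rule that[of "a + (r / 2) *\<^sub>R axis undefined 1"]) (use r in \<open>auto simp: norm_axis_1 axis_eq_0_iff intro!: r(2)\<close>)
  qed
  obtain y2 where y2: "y2 \<noteq> a" "G a y2 < p * (1 + z)"
  proof -
    have "p * (1 + z) > 0" using p_pos z by simp
    from G_far[OF this] obtain r where r: "\<And>y. norm y > r \<Longrightarrow> G a y < p * (1 + z)" by blast
    define s where "s = max \<bar>r\<bar> (norm a) + 1"
    have "norm (s *\<^sub>R axis undefined 1 :: real ^ 'n) = s" by (simp add: norm_axis_1 s_def)
    moreover have "s > r" "s > norm a" by (auto simp: s_def)
    ultimately show thesis
      using that[of "s *\<^sub>R axis undefined 1"] r[of "s *\<^sub>R axis undefined 1"] by force
  qed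
  have "p * (1 + z) \<in> G a ` (- {a})"
    using connectedD_interval[OF conn, of "G a y2" "G a y1" "p * (1 + z)"] y1 y2 by simp
  then obtain y where y: "y \<noteq> a" "G a y = p * (1 + z)" by (metis ComplD imageE singletonI)
  have t: "coshd a y > 1" using y(1) coshd_gt_1[of y a] by auto
  then have "(coshd a y)\<^sup>2 > 1" by simp
  then have "gker p a y > 0"
    unfolding gker_eq[OF y(1)] y(2) using dens_pos[of y] p_pos R_pos z(3) by simp
  then show ?thesis ..
qed

end

text \<open>Far out both truncations coincide with G. A single one stays positive there, so only
  differences can serve as test functions.\<close>

lemma compactly_supported_gcut_diff:
  assumes "p > 0" "q > 0"
  shows "compactly_supported (\<lambda>y. gcut p a y - gcut q a y)"
proof -
  obtain r where r: "\<And>y. norm y > r \<Longrightarrow> G a y < min p q"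
    using G_far[of "min p q"] assms by auto
  have "gcut p a y - gcut q a y = 0" if "norm y > max r (norm a)" for y
  proof -
    have "y \<noteq> a" "G a y \<le> p" "G a y \<le> q" using that r[of y] by auto
    then show ?thesis using gcut_eq_G[OF assms(1)] gcut_eq_G[OF assms(2)] by simp
  qed
  then show ?thesis unfolding compactly_supported_def by blast
qed

lemma smooth_on_gcut_diff:
  "p > 0 \<Longrightarrow> q > 0 \<Longrightarrow> smooth_on (\<lambda>y. gcut p a y - gcut q a y) UNIV"
  by (intro smooth_on_diff smooth_on_gcut) auto

lemma lapl_gcut_diff:
  "p > 0 \<Longrightarrow> q > 0 \<Longrightarrow> lapl (\<lambda>y. gcut p a y - gcut q a y) y = gker q a y - gker p a y"
  by (subst lapl_diff) (auto simp: smooth_on_gcut gker_def)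

text \<open>The flux of G out of its pole; level 1 is arbitrary by \<open>integral_gker\<close>.
  Geometrically it is R^(d-2) times the area of the unit sphere, but only its positivity and its
  independence of a enter.\<close>

definition mass :: "real ^ 'n \<Rightarrow> real" where
  "mass a = (\<integral>y. gker 1 a y \<partial>lborel)"

lemma integral_gker:
  assumes "p > 0"
  shows "(\<integral>y. gker p a y \<partial>lborel) = mass a"
proof -
  have "(\<integral>y. gker 1 a y - gker p a y \<partial>lborel) = 0"
    using lapl_integral_eq_0[OF smooth_on_gcut_diff compactly_supported_gcut_diff, of p 1 a] assms
    by (simp add: lapl_gcut_diff)
  then show ?thesis
    using integrable_gker[of 1 a] integrable_gker[OF assms, of a] by (simp add: mass_def)
qed

text \<open>With zero integral the nonnegative kernel would vanish almost everywhere, yet it is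
  positive on a nonempty open set.\<close>

lemma mass_pos: "mass a > 0"
proof (rule ccontr)
  assume "\<not> ?thesis"
  moreover have "mass a \<ge> 0" unfolding mass_def by (intro Bochner_Integration.integral_nonneg gker_nonneg) auto
  ultimately have "mass a = 0" by simp
  then have "AE y in lborel. gker 1 a y = 0"
    using integral_nonneg_eq_0_iff_AE[OF integrable_gker[of 1 a]] by (simp add: mass_def gker_nonneg)
  moreover have o: "open {y. gker 1 a y > 0}"
    by (intro open_Collect_less continuous_intros continuous_on_gker) auto
  ultimately have "{y. gker 1 a y > 0} \<in> null_sets lborel"
    by (intro AE_iff_null_sets[THEN iffD2]) (auto elim: eventually_mono)
  then have "negligible {y. gker 1 a y > 0}"
    using negligible_iff_null_sets null_sets_completionI by blast
  then show False using open_not_negligible[OF o] gker_pos_ex[of 1 a] by auto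
qed

text \<open>Nonnegativity turns a pointwise bound on the support of the kernel into a bound by the
  total mass. It is used with c = v a for shells near the pole and with c = 0 for shells near
  infinity.\<close>

lemma gker_approx:
  assumes "p > 0" "integrable lborel (\<lambda>y. v y * gker p a y)"
    "\<And>y. gker p a y \<noteq> 0 \<Longrightarrow> \<bar>v y - c\<bar> \<le> \<epsilon>"
  shows "\<bar>(\<integral>y. v y * gker p a y \<partial>lborel) - c * mass a\<bar> \<le> \<epsilon> * mass a"
proof -
  have "(\<integral>y. v y * gker p a y \<partial>lborel) - c * mass a = (\<integral>y. v y * gker p a y - c * gker p a y \<partial>lborel)"
    using assms(2) integrable_gker[OF assms(1), of a] integral_gker[OF assms(1), of a] by simp
  also have "\<bar>\<dots>\<bar> \<le> (\<integral>y. \<epsilon> * gker p a y \<partial>lborel)"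
  proof (rule integral_abs_bound_integral)
    show "\<bar>v y * gker p a y - c * gker p a y\<bar> \<le> \<epsilon> * gker p a y" for y
    proof (cases "gker p a y = 0")
      case False
      have "\<bar>v y * gker p a y - c * gker p a y\<bar> = \<bar>v y - c\<bar> * gker p a y"
        using gker_nonneg[OF assms(1), of a y] by (simp add: abs_mult flip: left_diff_distrib)
      also have "\<dots> \<le> \<epsilon> * gker p a y"
        by (intro mult_right_mono assms(3) False gker_nonneg assms(1))
      finally show ?thesis .
    qed simp
  qed (use assms(2) integrable_gker[OF assms(1)] in auto)
  also have "\<dots> = \<epsilon> * mass a" using integral_gker[OF assms(1), of a] by simp
  finally show ?thesis .
qed

end

section \<open>The fundamental solution\<close>

definition loc_integrable :: "('a::euclidean_space \<Rightarrow> real) \<Rightarrow> bool" where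
  "loc_integrable v \<longleftrightarrow> (\<forall>r. integrable lborel (\<lambda>y. indicator (cball 0 r) y * v y))"

lemma loc_integrable_mult:
  fixes v \<phi> :: "'a::euclidean_space \<Rightarrow> real"
  assumes v: "loc_integrable v" and \<phi>: "continuous_on UNIV \<phi>" "compactly_supported \<phi>"
  shows "integrable lborel (\<lambda>y. v y * \<phi> y)"
proof -
  obtain r where r: "\<And>y. norm y > r \<Longrightarrow> \<phi> y = 0"
    using \<phi>(2) by (auto simp: compactly_supported_def)
  obtain B where B: "\<And>y. \<bar>\<phi> y\<bar> \<le> B"
    using compactly_supported_bounded[OF \<phi>] by blast
  let ?w = "\<lambda>y. indicator (cball 0 r) y * v y"
  have w: "integrable lborel ?w" using v by (simp add: loc_integrable_def)
  have "integrable lborel (\<lambda>y. ?w y * \<phi> y)"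
  proof (rule Bochner_Integration.integrable_bound)
    show "integrable lborel (\<lambda>y. B * ?w y)" using w by (intro integrable_mult_right)
    show "(\<lambda>y. ?w y * \<phi> y) \<in> borel_measurable lborel"
      using borel_measurable_integrable[OF w] borel_measurable_continuous_onI[OF \<phi>(1)] by simp
    show "AE y in lborel. norm (?w y * \<phi> y) \<le> norm (B * ?w y)"
    proof (rule AE_I2)
      fix y
      have "\<bar>\<phi> y\<bar> \<le> \<bar>B\<bar>" using B[of y] by linarith
      then show "norm (?w y * \<phi> y) \<le> norm (B * ?w y)"
        using mult_right_mono[of "\<bar>\<phi> y\<bar>" "\<bar>B\<bar>" "\<bar>?w y\<bar>"] by (simp add: abs_mult mult.commute)
    qed
  qed
  moreover have "?w y * \<phi> y = v y * \<phi> y" for y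
    using r[of y] by (auto simp: indicator_def)
  ultimately show ?thesis by simp
qed

context hyperbolic_green
begin

lemma height_le_of_coshd_lt_2:
  assumes "coshd a y < 2"
  shows "height y \<le> 4 * height a"
proof -
  have "2 * height a * coshd a y \<le> 2 * height a * 2"
    using assms height_pos[of a] by (intro mult_left_mono) auto
  then show ?thesis using coshd_lower[of y a] by linarith
qed

lemma G_measurable: "G a \<in> borel_measurable borel"
  by (rule borel_measurable_continuous_countable_exceptions[of "{a}"]) (auto simp: continuous_on_G)

lemma G_nonneg_AE: "AE y in lborel. y \<noteq> a \<and> G a y \<ge> 0"
  using AE_lborel_singleton[of a] by eventually_elim (use G_pos in \<open>auto simp: less_imp_le\<close>)

lemma gcut_tendsto:
  assumes "y \<noteq> a"
  shows "(\<lambda>n. gcut (Suc n) a y) \<longlonglongrightarrow> G a y"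
proof (rule tendsto_eventually)
  obtain N :: nat where N: "G a y \<le> N" using real_arch_simple by blast
  show "\<forall>\<^sub>F n in sequentially. gcut (Suc n) a y = G a y"
    using eventually_ge_at_top[of N]
    by eventually_elim (use N assms in \<open>auto intro!: gcut_eq_G\<close>)
qed

text \<open>Testing against a truncation \<open>\<psi>\<close> of \<open>y \<mapsto> - coshd a y\<close>, which is strictly superharmonic near
  \<open>a\<close>, bounds the integrals of \<open>gcut p a\<close> near \<open>a\<close> uniformly in \<open>p\<close>.\<close>

lemma gcut_integral_bound:
  "\<exists>C. \<forall>p>0. (\<integral>y. indicator {y. coshd a y < 2} y * gcut p a y \<partial>lborel) \<le> C"
proof -
  \<comment> \<open>\<open>F t\<close> is -t for t <= 2 and 0 for t >= 3; the radius 6 * height a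
    below is \<open>coshd_lower\<close> at t = 3.\<close>
  define F where "F t = - t * (1 - smooth_step (t - 1 - 1))" for t
  define \<psi> where "\<psi> y = F (coshd a y)" for y
  define N where "N = {y. coshd a y < 2}"
  have N: "open N" unfolding N_def
    by (intro open_Collect_less continuous_on_coshd continuous_intros)
  have "smooth_on (\<lambda>t::real. t - 1) UNIV"
    by (intro smooth_on_diff smooth_on_linear smooth_on_const) auto
  then have "smooth_on (\<lambda>t. 1 - smooth_step (t - 1 - 1)) UNIV"
    by (rule smooth_on_compose[OF open_UNIV _ smooth_on_smooth_step_shift]) auto
  then have "smooth_on F UNIV" unfolding F_def[abs_def]
    by (intro smooth_on_mult[OF open_UNIV smooth_on_minus[OF open_UNIV smooth_on_linear]]) auto
  then have \<psi>: "smooth_on \<psi> UNIV" unfolding \<psi>_def[abs_def]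
    by (rule smooth_on_compose[OF open_UNIV smooth_on_coshd]) auto
  have far: "coshd a y \<ge> 3" if "norm y > 6 * height a" for y
  proof -
    have "2 * height a * 3 < 2 * height a * coshd a y"
      using that height_ge(2)[of y] coshd_lower[of y a] by linarith
    then show ?thesis using height_pos[of a] by simp
  qed
  then have "\<psi> y = 0" if "norm y > 6 * height a" for y
    using that by (simp add: \<psi>_def F_def smooth_step_eq_1)
  then have c\<psi>: "compactly_supported \<psi>" unfolding compactly_supported_def by blast
  have \<psi>_nonpos: "\<psi> y \<le> 0" for y
    using coshd_ge_1[of a y] smooth_step_bounds(2)[of "coshd a y - 1 - 1"]
    by (simp add: \<psi>_def F_def mult_nonneg_nonneg)
  define L where "L y = - lapl \<psi> y" for y
  have cL: "continuous_on UNIV L"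
    unfolding L_def[abs_def] by (intro continuous_intros smooth_on_imp_continuous_on smooth_on_lapl \<psi>)
  have sL: "compactly_supported L"
    unfolding L_def[abs_def] by (intro compactly_supported_minus compactly_supported_lapl c\<psi>)
  have iL: "integrable lborel (\<lambda>y. \<bar>L y\<bar>)"
    using integrable_compactly_supported[OF cL sL] by simp
  \<comment> \<open>On N the density is at least R / (4 * height a) and coshd is at least 1;
    inserting both into dens * d * coshd / R^2 gives this constant.\<close>
  define \<delta> where "\<delta> = CARD('n) / (4 * height a * R)"
  have \<delta>: "\<delta> > 0" using height_pos[of a] R_pos dim_ge_2 by (simp add: \<delta>_def)
  have L_lower: "L y \<ge> \<delta>" if y: "y \<in> N" for y
  proof -
    have "lapl \<psi> y = dens y / R\<^sup>2 * (((coshd a y)\<^sup>2 - 1) * 0 + CARD('n) * coshd a y * (-1))"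
      by (rule lapl_radial[of N _ "{..<2}" _ _ uminus "\<lambda>_. -1" "\<lambda>_. 0"])
        (use y N in \<open>auto simp: N_def \<psi>_def F_def smooth_step_eq_0 intro!: derivative_eq_intros\<close>)
    then have 1: "L y = dens y * (CARD('n) / R\<^sup>2) * coshd a y" by (simp add: L_def)
    have "height y \<le> 4 * height a"
      using y height_le_of_coshd_lt_2[of a y] by (simp add: N_def)
    then have "R / (4 * height a) \<le> dens y"
      unfolding dens_def using height_pos[of y] height_pos[of a] R_pos
      by (intro divide_left_mono) auto
    then have "R / (4 * height a) * (CARD('n) / R\<^sup>2) * 1 \<le> L y"
      unfolding 1 using coshd_ge_1[of a y] dens_pos[of y] by (intro mult_mono) auto
    then show ?thesis using R_pos by (simp add: \<delta>_def power2_eq_square)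
  qed
  define g where "g = profile CARD('n) 2"
  have g: "g > 0" unfolding g_def using dim_ge_2 by (intro profile_pos) auto
  have G_le: "G a y \<le> g" if "y \<notin> N" for y
  proof (cases "coshd a y = 2")
    case False
    then show ?thesis
      using that profile_less[OF _ _ dim_ge_2, of 2 "coshd a y"] by (simp add: G_def g_def N_def)
  qed (simp add: G_def g_def)
  have "(\<integral>y. indicator N y * gcut p a y \<partial>lborel) \<le> g * (\<integral>y. \<bar>L y\<bar> \<partial>lborel) / \<delta>" if p: "p > 0" for p
  proof -
    have iLg: "integrable lborel (\<lambda>y. gcut p a y * L y)"
      by (rule integrable_compactly_supported)
        (auto intro!: continuous_intros cL smooth_on_imp_continuous_on[OF smooth_on_gcut[OF p]]
          compactly_supported_mult sL)
    \<comment> \<open>Green's identity moves the operator onto the truncation. There it meets \<psi>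
      <= 0 and a nonnegative kernel, which gives a sign for every p at once.\<close>
    have "(\<integral>y. gcut p a y * L y \<partial>lborel) = (\<integral>y. \<psi> y * gker p a y \<partial>lborel)"
      using green[OF smooth_on_gcut[OF p, of a] \<psi> c\<psi>] by (simp add: L_def gker_def)
    also have "\<dots> \<le> 0"
    proof -
      have "0 \<le> (\<integral>y. - (\<psi> y * gker p a y) \<partial>lborel)"
        using \<psi>_nonpos gker_nonneg[OF p, of a]
        by (intro Bochner_Integration.integral_nonneg) (simp add: mult_le_0_iff)
      then show ?thesis by simp
    qed
    finally have neg: "(\<integral>y. gcut p a y * L y \<partial>lborel) \<le> 0" .
    \<comment> \<open>On N, L is at least \<delta>. Off N, L may be negative, but the truncation is
      at most g there, so g |L| pays for it. The resulting bound is free of p.\<close>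
    have pt: "\<delta> * (indicator N y * gcut p a y) \<le> gcut p a y * L y + g * \<bar>L y\<bar>" for y
    proof (cases "y \<in> N")
      case True
      then have "\<delta> * gcut p a y \<le> L y * gcut p a y"
        using L_lower gcut_nonneg[OF p, of a y] by (intro mult_right_mono) auto
      then show ?thesis using True g by (simp add: mult.commute add_increasing2)
    next
      case False
      then have "y \<noteq> a" by (auto simp: N_def coshd_self)
      then have "gcut p a y \<le> g" using gcut_le_G[OF p] G_le[OF False] by fastforce
      then have "gcut p a y * \<bar>L y\<bar> \<le> g * \<bar>L y\<bar>" by (intro mult_right_mono) auto
      moreover have "- (gcut p a y * L y) \<le> gcut p a y * \<bar>L y\<bar>"
        using gcut_nonneg[OF p, of a y] by (metis abs_ge_minus_self abs_mult abs_of_nonneg)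
      ultimately show ?thesis using False by simp
    qed
    have "\<delta> * (\<integral>y. indicator N y * gcut p a y \<partial>lborel) = (\<integral>y. \<delta> * (indicator N y * gcut p a y) \<partial>lborel)"
      by simp
    also have "\<dots> \<le> (\<integral>y. gcut p a y * L y + g * \<bar>L y\<bar> \<partial>lborel)"
    proof (rule integral_mono_AE')
      have "0 \<le> gcut p a y * L y + g * \<bar>L y\<bar>" for y
        using pt[of y] \<delta> gcut_nonneg[OF p, of a y] by (intro order_trans[OF _ pt[of y]]) auto
      then show "AE y in lborel. 0 \<le> gcut p a y * L y + g * \<bar>L y\<bar>" by simp
    qed (use iLg iL pt in auto)
    also have "\<dots> \<le> g * (\<integral>y. \<bar>L y\<bar> \<partial>lborel)"
      using iLg iL neg by simp
    finally show ?thesis using \<delta> by (simp add: field_simps)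
  qed
  then show ?thesis unfolding N_def by blast
qed

text \<open>Fatou's lemma along the levels n + 1 carries the uniform bound for the truncations over
  to G near the pole; where coshd is at least 2, G is bounded by its value at 2.\<close>

lemma loc_integrable_G: "loc_integrable (G a)"
proof -
  define N where "N = {y. coshd a y < 2}"
  have N: "open N" unfolding N_def
    by (intro open_Collect_less continuous_on_coshd continuous_intros)
  have bN: "norm y \<le> 4 * height a" if "y \<in> N" for y
    using that height_ge(2)[of y] height_le_of_coshd_lt_2[of a y] by (simp add: N_def)
  have [measurable]: "G a \<in> borel_measurable borel" by (rule G_measurable)
  have [measurable]: "gcut (real (Suc n)) a \<in> borel_measurable borel" for n
    by (intro borel_measurable_continuous_onI smooth_on_imp_continuous_on smooth_on_gcut) simp
  have [measurable]: "N \<in> sets borel" using N by simp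
  obtain C where C: "\<And>p. p > 0 \<Longrightarrow> (\<integral>y. indicator N y * gcut p a y \<partial>lborel) \<le> C"
    using gcut_integral_bound[of a] unfolding N_def by blast
  have iN: "integrable lborel (\<lambda>y. indicator N y * gcut (real (Suc n)) a y)" for n
  proof (rule Bochner_Integration.integrable_bound)
    show "integrable lborel (\<lambda>y. indicator (cball 0 (4 * height a)) y *\<^sub>R gcut (real (Suc n)) a y)"
      by (intro borel_integrable_compact smooth_on_imp_continuous_on
          smooth_on_subset[OF smooth_on_gcut]) auto
    show "(\<lambda>y. indicator N y * gcut (real (Suc n)) a y) \<in> borel_measurable lborel"
      by measurable
  qed (use bN in \<open>auto simp: indicator_def\<close>)
  have "(\<integral>\<^sup>+y. ennreal (indicator N y * G a y) \<partial>lborel)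
      = (\<integral>\<^sup>+y. liminf (\<lambda>n. ennreal (indicator N y * gcut (Suc n) a y)) \<partial>lborel)"
  proof (rule nn_integral_cong_AE)
    show "AE y in lborel. ennreal (indicator N y * G a y)
        = liminf (\<lambda>n. ennreal (indicator N y * gcut (Suc n) a y))"
      using AE_lborel_singleton[of a]
    proof eventually_elim
      case (elim y)
      have "(\<lambda>n. ennreal (indicator N y * gcut (Suc n) a y)) \<longlonglongrightarrow> ennreal (indicator N y * G a y)"
        by (intro tendsto_ennrealI tendsto_mult tendsto_const gcut_tendsto elim)
      then show ?case by (simp add: lim_imp_Liminf)
    qed
  qed
  also have "\<dots> \<le> liminf (\<lambda>n. \<integral>\<^sup>+y. ennreal (indicator N y * gcut (Suc n) a y) \<partial>lborel)"
    by (rule nn_integral_liminf) measurable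
  also have "\<dots> \<le> ennreal C"
  proof (rule Liminf_le)
    have "(\<integral>\<^sup>+y. ennreal (indicator N y * gcut (Suc n) a y) \<partial>lborel) \<le> ennreal C" for n
      using nn_integral_eq_integral[OF iN[of n]] C[of "Suc n"] gcut_nonneg[of "Suc n" a]
      by (simp add: ennreal_leI)
    then show "\<forall>\<^sub>F n in sequentially. (\<integral>\<^sup>+y. ennreal (indicator N y * gcut (Suc n) a y) \<partial>lborel) \<le> ennreal C"
      by simp
  qed simp
  finally have fin: "(\<integral>\<^sup>+y. ennreal (indicator N y * G a y) \<partial>lborel) < \<infinity>"
    by (simp add: le_less_trans)
  have iG: "integrable lborel (\<lambda>y. indicator N y * G a y)"
  proof (rule integrableI_nonneg)
    show "AE y in lborel. 0 \<le> indicator N y * G a y"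
      using G_nonneg_AE[of a] by eventually_elim simp
  qed (use fin in auto)
  have G_le: "G a y \<le> profile CARD('n) 2" if "y \<notin> N" for y
  proof (cases "coshd a y = 2")
    case False
    then show ?thesis
      using that profile_less[OF _ _ dim_ge_2, of 2 "coshd a y"] by (simp add: G_def N_def)
  qed (simp add: G_def)
  show ?thesis unfolding loc_integrable_def
  proof
    fix r
    have "integrable lborel (\<lambda>y::real ^ 'n. indicator (cball 0 r) y *\<^sub>R profile CARD('n) 2)"
      by (intro borel_integrable_compact) auto
    then have "integrable lborel (\<lambda>y. indicator N y * G a y + indicator (cball 0 r) y *\<^sub>R profile CARD('n) 2)"
      using iG by (intro Bochner_Integration.integrable_add)
    then show "integrable lborel (\<lambda>y. indicator (cball 0 r) y * G a y)"
    proof (rule Bochner_Integration.integrable_bound)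
      have "profile CARD('n) 2 \<ge> 0" by (intro profile_nonneg) simp
      show "AE y in lborel. norm (indicator (cball 0 r) y * G a y)
          \<le> norm (indicator N y * G a y + indicator (cball 0 r) y *\<^sub>R profile CARD('n) 2)"
        using G_nonneg_AE[of a]
        by eventually_elim (use \<open>profile CARD('n) 2 \<ge> 0\<close> G_le in \<open>auto simp: indicator_def\<close>)
      have [measurable]: "cball (0 :: real ^ 'n) r \<in> sets borel" by simp
      show "(\<lambda>y. indicator (cball 0 r) y * G a y) \<in> borel_measurable lborel" by measurable
    qed
  qed
qed

section \<open>Limits of the kernels and the representation of solutions\<close>

lemma integral_gker_near_tendsto:
  assumes "isCont v a" "\<And>p. p > 0 \<Longrightarrow> integrable lborel (\<lambda>y. v y * gker p a y)"
  shows "(\<lambda>n. \<integral>y. v y * gker (Suc n) a y \<partial>lborel) \<longlonglongrightarrow> v a * mass a"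
proof (rule LIMSEQ_I)
  fix \<epsilon> :: real assume "\<epsilon> > 0"
  define e where "e = \<epsilon> / (2 * mass a)"
  have e: "e > 0" "e * mass a < \<epsilon>" using \<open>\<epsilon> > 0\<close> mass_pos[of a] by (auto simp: e_def)
  obtain r where r: "r > 0" "\<And>y. norm (y - a) < r \<Longrightarrow> \<bar>v y - v a\<bar> < e"
    using assms(1) e(1) unfolding continuous_at_eps_delta by (auto simp: dist_norm)
  obtain M where M: "M > 0" "\<And>y. y \<noteq> a \<Longrightarrow> G a y > M \<Longrightarrow> norm (y - a) < r"
    using G_large_imp_near[OF r(1)] by blast
  obtain N :: nat where N: "M \<le> N" using real_arch_simple by blast
  have "norm ((\<integral>y. v y * gker (Suc n) a y \<partial>lborel) - v a * mass a) < \<epsilon>" if "n \<ge> N" for n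
  proof -
    have "\<bar>(\<integral>y. v y * gker (Suc n) a y \<partial>lborel) - v a * mass a\<bar> \<le> e * mass a"
    proof (rule gker_approx)
      fix y assume y: "gker (Suc n) a y \<noteq> 0"
      then have "y \<noteq> a" "real (Suc n) < G a y" using gker_nonzeroD[of "Suc n" a y] by auto
      moreover have "M < Suc n" using N that by simp
      ultimately show "\<bar>v y - v a\<bar> \<le> e" using M(2)[of y] r(2)[of y] by simp
    qed (use assms(2) in auto)
    then show ?thesis using e by simp
  qed
  then show "\<exists>N. \<forall>n\<ge>N. norm ((\<integral>y. v y * gker (Suc n) a y \<partial>lborel) - v a * mass a) < \<epsilon>" by blast
qed

lemma integral_gker_far_tendsto:
  assumes "\<And>\<epsilon>. \<epsilon> > 0 \<Longrightarrow> \<exists>r. \<forall>y. norm y > r \<longrightarrow> \<bar>v y\<bar> < \<epsilon>"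
    "\<And>p. p > 0 \<Longrightarrow> integrable lborel (\<lambda>y. v y * gker p a y)"
  shows "(\<lambda>n. \<integral>y. v y * gker (inverse (Suc n)) a y \<partial>lborel) \<longlonglongrightarrow> 0"
proof (rule LIMSEQ_I)
  fix \<epsilon> :: real assume "\<epsilon> > 0"
  define e where "e = \<epsilon> / (2 * mass a)"
  have e: "e > 0" "e * mass a < \<epsilon>" using \<open>\<epsilon> > 0\<close> mass_pos[of a] by (auto simp: e_def)
  obtain r where r: "\<And>y. norm y > r \<Longrightarrow> \<bar>v y\<bar> < e"
    using assms(1)[OF e(1)] by blast
  obtain q where q: "q > 0" "\<And>y. y \<noteq> a \<Longrightarrow> G a y < q \<Longrightarrow> norm y > r"
    using G_small_imp_far by blast
  \<comment> \<open>The shell of level p reaches up to 2 * p, so p < q / 2 puts it into the region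
    where G is below q.\<close>
  obtain N where N: "\<And>n. n \<ge> N \<Longrightarrow> inverse (real (Suc n)) < q / 2"
    using LIMSEQ_D[OF LIMSEQ_inverse_real_of_nat, of "q / 2"] q(1) by auto
  have "norm ((\<integral>y. v y * gker (inverse (Suc n)) a y \<partial>lborel) - 0) < \<epsilon>" if "n \<ge> N" for n
  proof -
    have "\<bar>(\<integral>y. v y * gker (inverse (Suc n)) a y \<partial>lborel) - 0 * mass a\<bar> \<le> e * mass a"
    proof (rule gker_approx)
      fix y assume y: "gker (inverse (Suc n)) a y \<noteq> 0"
      then have "y \<noteq> a" "G a y < 2 * inverse (Suc n)"
        using gker_nonzeroD[of "inverse (Suc n)" a y] by auto
      then show "\<bar>v y - 0\<bar> \<le> e" using N[OF that] q(2)[of y] r[of y] by simp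
    qed (use assms(2) in auto)
    then show ?thesis using e by simp
  qed
  then show "\<exists>N. \<forall>n\<ge>N. norm ((\<integral>y. v y * gker (inverse (Suc n)) a y \<partial>lborel) - 0) < \<epsilon>" by blast
qed

text \<open>Green's identity is exact for the smooth truncations. Since they increase to at most G,
  \<open>loc_integrable_G\<close> supplies the dominating function for the passage to G
  itself.\<close>

lemma integral_G_lapl:
  assumes \<phi>: "smooth_on \<phi> UNIV" "compactly_supported \<phi>"
  shows "(\<integral>y. G a y * - lapl \<phi> y \<partial>lborel) = mass a * \<phi> a"
proof -
  define L where "L y = - lapl \<phi> y" for y
  have cL: "continuous_on UNIV L"
    unfolding L_def[abs_def] by (intro continuous_intros smooth_on_imp_continuous_on smooth_on_lapl \<phi>)
  have sL: "compactly_supported L"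
    unfolding L_def[abs_def] by (intro compactly_supported_minus compactly_supported_lapl \<phi>)
  have [measurable]: "G a \<in> borel_measurable borel" "L \<in> borel_measurable borel"
    using G_measurable cL by (auto intro: borel_measurable_continuous_onI)
  have [measurable]: "gcut (real (Suc n)) a \<in> borel_measurable borel" for n
    by (intro borel_measurable_continuous_onI smooth_on_imp_continuous_on smooth_on_gcut) simp
  have "(\<lambda>n. \<integral>y. gcut (Suc n) a y * L y \<partial>lborel) \<longlonglongrightarrow> (\<integral>y. G a y * L y \<partial>lborel)"
  proof (rule integral_dominated_convergence[where w = "\<lambda>y. G a y * \<bar>L y\<bar>"])
    show "integrable lborel (\<lambda>y. G a y * \<bar>L y\<bar>)"
      by (intro loc_integrable_mult loc_integrable_G continuous_intros cL compactly_supported_abs sL)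
    show "AE y in lborel. (\<lambda>n. gcut (Suc n) a y * L y) \<longlonglongrightarrow> G a y * L y"
      using AE_lborel_singleton[of a]
      by eventually_elim (intro tendsto_mult tendsto_const gcut_tendsto)
    show "AE y in lborel. norm (gcut (Suc n) a y * L y) \<le> G a y * \<bar>L y\<bar>" for n
      using AE_lborel_singleton[of a]
    proof eventually_elim
      case (elim y)
      have "0 \<le> gcut (real (Suc n)) a y" "gcut (real (Suc n)) a y \<le> G a y"
        using gcut_nonneg[of "Suc n" a y] gcut_le_G[OF _ elim, of "Suc n"] by auto
      then show ?case by (simp add: abs_mult mult_right_mono)
    qed
  qed (simp_all del: of_nat_Suc)
  moreover have "(\<lambda>n. \<integral>y. gcut (Suc n) a y * L y \<partial>lborel) \<longlonglongrightarrow> \<phi> a * mass a"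
  proof -
    have "(\<integral>y. gcut (Suc n) a y * L y \<partial>lborel) = (\<integral>y. \<phi> y * gker (Suc n) a y \<partial>lborel)" for n
      using green[OF smooth_on_gcut[of "Suc n" a] \<phi>] by (simp add: L_def gker_def)
    moreover have "(\<lambda>n. \<integral>y. \<phi> y * gker (Suc n) a y \<partial>lborel) \<longlonglongrightarrow> \<phi> a * mass a"
    proof (rule integral_gker_near_tendsto)
      show "isCont \<phi> a"
        using smooth_on_imp_continuous_on[OF \<phi>(1)] by (simp add: continuous_on_eq_continuous_at)
      show "integrable lborel (\<lambda>y. \<phi> y * gker p a y)" if "p > 0" for p
        using that by (intro integrable_compactly_supported continuous_intros continuous_on_gker
          compactly_supported_mult \<phi> smooth_on_imp_continuous_on)
    qed
    ultimately show ?thesis by simp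
  qed
  ultimately have "(\<integral>y. G a y * L y \<partial>lborel) = \<phi> a * mass a"
    by (rule LIMSEQ_unique)
  then show ?thesis by (simp add: L_def mult.commute)
qed

text \<open>A reciprocity law: the pole of the test function is put at the point a where v is to be
  evaluated. The equation then yields values of truncations at b, where they converge because b
  differs from a.\<close>

lemma solution_value:
  assumes v: "loc_integrable v"
    and weak: "\<And>\<phi>. smooth_on \<phi> UNIV \<Longrightarrow> compactly_supported \<phi> \<Longrightarrow>
      (\<integral>y. v y * - lapl \<phi> y \<partial>lborel) = c * \<phi> b"
    and cont: "isCont v a" and ab: "a \<noteq> b"
    and decay: "\<And>\<epsilon>. \<epsilon> > 0 \<Longrightarrow> \<exists>r. \<forall>y. norm y > r \<longrightarrow> \<bar>v y\<bar> < \<epsilon>"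
  shows "mass a * v a = c * G a b"
proof -
  have int: "integrable lborel (\<lambda>y. v y * gker p a y)" if "p > 0" for p
    using that by (intro loc_integrable_mult v continuous_on_gker compactly_supported_gker)
  have "(\<integral>y. v y * gker (Suc n) a y \<partial>lborel) - (\<integral>y. v y * gker (inverse (Suc n)) a y \<partial>lborel)
      = c * (gcut (Suc n) a b - gcut (inverse (Suc n)) a b)" for n
  proof -
    have pos: "real (Suc n) > 0" "inverse (real (Suc n)) > 0" by auto
    have "(\<integral>y. v y * - (gker (inverse (Suc n)) a y - gker (Suc n) a y) \<partial>lborel)
      = c * (gcut (Suc n) a b - gcut (inverse (Suc n)) a b)"
      using weak[OF smooth_on_gcut_diff[OF pos] compactly_supported_gcut_diff[OF pos], of a]
      unfolding lapl_gcut_diff[OF pos] .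
    also have "(\<lambda>y. v y * - (gker (inverse (Suc n)) a y - gker (Suc n) a y))
      = (\<lambda>y. v y * gker (Suc n) a y - v y * gker (inverse (Suc n)) a y)"
      by (simp add: algebra_simps)
    finally show ?thesis using int[OF pos(1)] int[OF pos(2)] by simp
  qed
  moreover have "(\<lambda>n. (\<integral>y. v y * gker (Suc n) a y \<partial>lborel) - (\<integral>y. v y * gker (inverse (Suc n)) a y \<partial>lborel))
      \<longlonglongrightarrow> v a * mass a - 0"
    by (intro tendsto_diff integral_gker_near_tendsto integral_gker_far_tendsto cont int decay)
  moreover have "(\<lambda>n. c * (gcut (Suc n) a b - gcut (inverse (Suc n)) a b)) \<longlonglongrightarrow> c * (G a b - 0)"
  proof (intro tendsto_mult tendsto_const tendsto_diff gcut_tendsto)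
    show "b \<noteq> a" using ab by simp
    have "(\<lambda>n. 2 * inverse (real (Suc n))) \<longlonglongrightarrow> 2 * 0"
      by (intro tendsto_mult tendsto_const LIMSEQ_inverse_real_of_nat)
    then have lim: "(\<lambda>n. 2 * inverse (real (Suc n))) \<longlonglongrightarrow> 0" by simp
    \<comment> \<open>A truncation of level q is at most 2 * q everywhere, hence also at b.\<close>
    show "(\<lambda>n. gcut (inverse (Suc n)) a b) \<longlonglongrightarrow> 0"
      by (rule tendsto_sandwich[OF _ _ tendsto_const lim])
        (auto intro!: always_eventually gcut_nonneg gcut_le simp del: of_nat_Suc)
  qed
  ultimately have "v a * mass a = c * G a b" using LIMSEQ_unique by fastforce
  then show ?thesis by (simp add: mult.commute)
qed

lemma isCont_G: "y \<noteq> a \<Longrightarrow> isCont (G a) y"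
  using continuous_on_G[of a] by (subst (asm) continuous_on_eq_continuous_at) auto

lemma G_decay:
  assumes "\<epsilon> > 0"
  shows "\<exists>r. \<forall>y. norm y > r \<longrightarrow> \<bar>G a y\<bar> < \<epsilon>"
proof -
  obtain r where r: "\<And>y. norm y > r \<Longrightarrow> G a y < \<epsilon>" using G_far[OF assms] by blast
  have "\<bar>G a y\<bar> < \<epsilon>" if "norm y > max r (norm a)" for y
    using that r[of y] G_pos[of y a] by fastforce
  then show ?thesis by blast
qed

lemma mass_const: "mass a = mass b"
proof (cases "a = b")
  case False
  have "mass a * G b a = mass b * G a b"
    using False by (intro solution_value loc_integrable_G integral_G_lapl isCont_G G_decay)
  then show ?thesis using G_pos[of a b] False by (simp add: G_commute)
qed simp

end

section \<open>Transfer from the chart to the hyperboloid\<close>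

text \<open>An orthogonal map carries an axis vector of length |u| to u. Conjugation by it makes the
  matrix diagonal, with 1 + c |u|^2 in one place and 1 elsewhere. The metric in the chart has this
  form.\<close>

lemma det_identity_plus_rank_one:
  fixes u :: "real ^ 'n::finite"
  shows "det (\<chi> i j. (if i = j then 1 else 0) + c * (u $ i * u $ j)) = 1 + c * (norm u)\<^sup>2"
proof -
  define k :: 'n where "k = undefined"
  have "norm (axis k (norm u) :: real ^ 'n) = norm u" by (simp add: norm_eq_sqrt_inner inner_axis_axis)
  then obtain f where f: "orthogonal_transformation f" "f (axis k (norm u)) = u"
    using orthogonal_transformation_exists by metis
  define Q where "Q = matrix f"
  have Q: "orthogonal_matrix Q" and fQ: "f v = Q *v v" for v
    using f(1) by (auto simp: Q_def orthogonal_transformation_matrix matrix_works)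
  have u: "u $ i = Q $ i $ k * norm u" for i
    using arg_cong[OF f(2)[unfolded fQ], of "\<lambda>w. w $ i"]
    by (simp add: matrix_vector_mult_def axis_def if_distrib cong: if_cong)
  have QQ: "(\<Sum>l\<in>UNIV. Q $ i $ l * Q $ j $ l) = (if i = j then 1 else 0)" for i j
    using Q unfolding orthogonal_matrix_def
    by (auto simp: vec_eq_iff matrix_matrix_mult_def transpose_def mat_def)
  define e where "e l = (if l = k then 1 + c * (norm u)\<^sup>2 else 1)" for l
  define D :: "real ^ 'n ^ 'n" where "D = (\<chi> i j. if i = j then e i else 0)"
  have "(\<chi> i j. (if i = j then 1 else 0) + c * (u $ i * u $ j)) = Q ** D ** transpose Q"
  proof -
    have "(Q ** D ** transpose Q) $ i $ j = (if i = j then 1 else 0) + c * (u $ i * u $ j)" for i j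
    proof -
      have "(Q ** D ** transpose Q) $ i $ j
        = (\<Sum>l\<in>UNIV. Q $ i $ l * e l * Q $ j $ l)"
        by (simp add: matrix_matrix_mult_def transpose_def D_def if_distrib cong: if_cong)
      also have "\<dots> = (\<Sum>l\<in>UNIV. Q $ i $ l * Q $ j $ l
          + (if l = k then c * (norm u)\<^sup>2 * (Q $ i $ l * Q $ j $ l) else 0))"
        by (intro sum.cong refl) (auto simp: e_def algebra_simps)
      also have "\<dots> = (if i = j then 1 else 0) + c * (norm u)\<^sup>2 * (Q $ i $ k * Q $ j $ k)"
        by (simp add: sum.distrib QQ)
      also have "\<dots> = (if i = j then 1 else 0) + c * (u $ i * u $ j)"
        by (simp add: u[of i] u[of j] power2_eq_square mult_ac)
      finally show ?thesis .
    qed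
    then show ?thesis by (simp add: vec_eq_iff)
  qed
  also have "det \<dots> = det D"
    using det_orthogonal_matrix[OF Q] by (auto simp: det_mul)
  also have "det D = (\<Prod>i\<in>UNIV. e i)"
    by (subst det_diagonal) (auto simp: D_def)
  also have "\<dots> = 1 + c * (norm u)\<^sup>2" by (simp add: e_def)
  finally show ?thesis .
qed

lemma matrix_inv_eqI:
  fixes A B :: "real ^ 'n::finite ^ 'n"
  assumes "A ** B = mat 1"
  shows "matrix_inv A = B"
proof -
  have "B ** A = mat 1" using assms by (simp add: matrix_left_right_inverse)
  then have "invertible A" using assms unfolding invertible_def by blast
  then have "matrix_inv A ** A = mat 1"
    by (metis (mono_tags, lifting) invertible_def matrix_inv_def someI_ex)
  then have "matrix_inv A ** (A ** B) = B" by (simp add: matrix_mul_assoc)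
  then show ?thesis using assms by simp
qed

context hyperbolic_chart
begin

section \<open>Metric, volume and distributions in the chart\<close>

lemma hyp_param_eq: "hyp_param R y = (height y, y)"
  by (simp add: hyp_param_def height_def)

lemma hyp_param_minkowski: "minkowski (hyp_param R a) (hyp_param R y) = R\<^sup>2 * coshd a y"
  by (simp add: minkowski_def hyp_param_eq coshd_def inner_vec_def)

lemma hyp_param_mem: "hyp_param R y \<in> hyperboloid R"
  using height_pos[of y] by (simp add: hyperboloid_def hyp_param_minkowski coshd_self) (simp add: hyp_param_eq)

lemma hyperboloidD:
  assumes "x \<in> hyperboloid R"
  shows "x = hyp_param R (snd x)"
proof -
  have "minkowski x x = (fst x)\<^sup>2 - (norm (snd x))\<^sup>2"
    unfolding minkowski_def power2_norm_eq_inner by (simp add: inner_vec_def power2_eq_square)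
  then have "(fst x)\<^sup>2 = R\<^sup>2 + (norm (snd x))\<^sup>2" "fst x > 0"
    using assms by (auto simp: hyperboloid_def)
  then have "fst x = height (snd x)"
    unfolding height_def by (metis less_imp_le real_sqrt_unique)
  then show ?thesis by (simp add: hyp_param_eq prod_eq_iff)
qed

lemma snd_hyp_param [simp]: "snd (hyp_param R y) = y"
  by (simp add: hyp_param_eq)

lemma hyp_param_eq_iff [simp]: "hyp_param R y = hyp_param R z \<longleftrightarrow> y = z"
  by (auto simp: hyp_param_eq)

lemma hyp_param_has_derivative:
  "(hyp_param R has_derivative (\<lambda>v. ((y \<bullet> v) / height y, v))) (at y)"
  unfolding hyp_param_eq[abs_def] by (intro has_derivative_Pair height_has_derivative has_derivative_ident)

lemma continuous_on_hyp_param: "continuous_on S (hyp_param R)"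
  by (meson hyp_param_has_derivative continuous_at_imp_continuous_on has_derivative_continuous)

lemma hyp_metric_eq:
  "hyp_metric R y = (\<chi> i j. (if i = j then 1 else 0) + - (1 / (height y)\<^sup>2) * (y $ i * y $ j))"
proof -
  have fd: "frechet_derivative (hyp_param R) (at y) = (\<lambda>v. ((y \<bullet> v) / height y, v))"
    by (rule frechet_derivative_at[OF hyp_param_has_derivative, symmetric])
  have "(\<Sum>k\<in>UNIV. (axis i 1 :: real ^ 'a) $ k * axis j 1 $ k) = (if i = j then 1 else 0)" for i j
    using inner_axis_axis[of i "1::real" j 1] by (simp add: inner_vec_def)
  then show ?thesis
    unfolding hyp_metric_def fd minkowski_def
    by (simp add: inner_axis vec_eq_iff power2_eq_square)
qed

lemma vol_density_eq: "vol_density R y = dens y"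
proof -
  have "det (hyp_metric R y) = 1 + - (1 / (height y)\<^sup>2) * (norm y)\<^sup>2"
    unfolding hyp_metric_eq by (rule det_identity_plus_rank_one)
  also have "\<dots> = (R / height y)\<^sup>2"
    using height_sq[of y] by (simp add: field_simps)
  finally show ?thesis
    using R_pos height_pos[of y] by (simp add: vol_density_def dens_def)
qed

lemma matrix_inv_hyp_metric: "matrix_inv (hyp_metric R y) $ i $ j = ginv y i j"
proof -
  have "hyp_metric R y ** (\<chi> i j. ginv y i j) = mat 1"
  proof -
    have "(hyp_metric R y ** (\<chi> i j. ginv y i j)) $ i $ j = mat 1 $ i $ j" for i j
    proof -
      have "(hyp_metric R y ** (\<chi> i j. ginv y i j)) $ i $ j
        = (\<Sum>k\<in>UNIV. ((if i = k then 1 else 0) + - (1 / (height y)\<^sup>2) * (y $ i * y $ k)) * ginv y k j)"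
        by (simp add: matrix_matrix_mult_def hyp_metric_eq)
      also have "\<dots> = (\<Sum>k\<in>UNIV. (if i = k then ginv y i j else 0)
          + (if k = j then - (1 / (height y)\<^sup>2) * (y $ i * y $ j) else 0)
          + - (1 / (height y)\<^sup>2) * (y $ i * y $ j) / R\<^sup>2 * (y $ k * y $ k))"
        by (intro sum.cong refl) (auto simp: ginv_def algebra_simps)
      also have "\<dots> = ginv y i j - (1 / (height y)\<^sup>2) * (y $ i * y $ j)
          - (1 / (height y)\<^sup>2) * (y $ i * y $ j) / R\<^sup>2 * (\<Sum>k\<in>UNIV. y $ k * y $ k)"
        by (simp only: sum.distrib sum_distrib_left[symmetric]) simp
      also have "(\<Sum>k\<in>UNIV. y $ k * y $ k) = (height y)\<^sup>2 - R\<^sup>2"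
        using height_sq[of y] by (simp add: power2_norm_eq_inner inner_vec_def)
      also have "ginv y i j - (1 / (height y)\<^sup>2) * (y $ i * y $ j)
          - (1 / (height y)\<^sup>2) * (y $ i * y $ j) / R\<^sup>2 * ((height y)\<^sup>2 - R\<^sup>2) = (if i = j then 1 else 0)"
        by (simp add: ginv_def field_simps)
      finally show ?thesis by (simp add: mat_def)
    qed
    then show ?thesis by (simp add: vec_eq_iff)
  qed
  from matrix_inv_eqI[OF this] show ?thesis by simp
qed

lemma laplace_beltrami_hyp_param:
  "laplace_beltrami R f (hyp_param R y) = lapl (\<lambda>y. f (hyp_param R y)) y / dens y"
  by (simp add: laplace_beltrami_def lapl_def vol_density_eq matrix_inv_hyp_metric)

lemma hyp_param_measurable: "hyp_param R \<in> measurable borel (restrict_space borel (hyperboloid R))"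
  by (rule measurable_restrict_space2)
    (auto simp: hyp_param_mem intro: borel_measurable_continuous_onI continuous_on_hyp_param)

lemma dens_measurable: "dens \<in> borel_measurable borel"
  by (intro borel_measurable_continuous_onI smooth_on_imp_continuous_on smooth_on_dens)

text \<open>On the hyperboloid, u is its chart expression composed with \<open>snd\<close>.\<close>

lemma measurable_hyperboloid:
  fixes u :: "real \<times> (real ^ 'n) \<Rightarrow> real"
  assumes "(\<lambda>y. u (hyp_param R y)) \<in> borel_measurable borel"
  shows "u \<in> borel_measurable (restrict_space borel (hyperboloid R))"
proof -
  have "snd \<in> borel_measurable (borel :: (real \<times> (real ^ 'n)) measure)"
    by (intro borel_measurable_continuous_onI continuous_intros)
  from measurable_compose[OF this assms]
  have "(\<lambda>x. u (hyp_param R (snd x))) \<in> borel_measurable (restrict_space borel (hyperboloid R))"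
    by (rule measurable_restrict_space1)
  then show ?thesis
    by (rule measurable_cong[THEN iffD1, rotated])
      (simp add: space_restrict_space hyperboloidD[symmetric])
qed

lemma hyp_vol_eq:
  "hyp_vol R = distr (density lborel (\<lambda>y. ennreal (dens y))) (restrict_space borel (hyperboloid R)) (hyp_param R)"
  by (simp add: hyp_vol_def vol_density_eq)

lemma
  fixes u :: "real \<times> (real ^ 'n) \<Rightarrow> real"
  assumes "(\<lambda>y. u (hyp_param R y)) \<in> borel_measurable borel"
  shows integral_hyp_vol: "(\<integral>x. u x \<partial>hyp_vol R) = (\<integral>y. dens y * u (hyp_param R y) \<partial>lborel)"
    and integrable_hyp_vol: "integrable (hyp_vol R) u \<longleftrightarrow> integrable lborel (\<lambda>y. dens y * u (hyp_param R y))"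
proof -
  note [measurable] = measurable_hyperboloid[OF assms] assms dens_measurable
  have [measurable]: "hyp_param R \<in> measurable (density lborel (\<lambda>y. ennreal (dens y)))
      (restrict_space borel (hyperboloid R))"
    using hyp_param_measurable by simp
  have pos: "AE y in lborel. 0 \<le> dens y" by (intro AE_I2) (simp add: less_imp_le dens_pos)
  show "(\<integral>x. u x \<partial>hyp_vol R) = (\<integral>y. dens y * u (hyp_param R y) \<partial>lborel)"
    unfolding hyp_vol_eq by (simp add: integral_distr integral_density pos)
  show "integrable (hyp_vol R) u \<longleftrightarrow> integrable lborel (\<lambda>y. dens y * u (hyp_param R y))"
    unfolding hyp_vol_eq by (simp add: integrable_distr_eq integrable_density pos)
qed

lemma compact_chart: "compact (hyp_param R ` cball 0 r)" "hyp_param R ` S \<subseteq> hyperboloid R"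
  by (auto intro!: compact_continuous_image continuous_on_hyp_param hyp_param_mem)

lemma compact_hyperboloid_bounded:
  assumes "compact K"
  obtains r where "\<And>y. hyp_param R y \<in> K \<Longrightarrow> norm y \<le> r"
proof -
  obtain r where r: "\<forall>x\<in>K. norm x \<le> r"
    using compact_imp_bounded[OF assms] by (auto simp: bounded_iff)
  have "norm y \<le> r" if "hyp_param R y \<in> K" for y
  proof -
    have "norm y \<le> norm (hyp_param R y)" using norm_snd_le[of y "height y"] by (simp add: hyp_param_eq)
    then show ?thesis using r that by force
  qed
  then show thesis by (rule that)
qed

text \<open>Charted balls are compact and compact sets have bounded preimages, so the two
  exhaustions agree. The density is harmless: it is at most 1 and bounded below on balls.\<close>

lemma locally_integrable_iff:
  fixes u :: "real \<times> (real ^ 'n) \<Rightarrow> real"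
  assumes u: "(\<lambda>y. u (hyp_param R y)) \<in> borel_measurable borel"
  shows "locally_integrable R u \<longleftrightarrow> loc_integrable (\<lambda>y. u (hyp_param R y))"
proof
  note [measurable] = u dens_measurable
  assume *: "locally_integrable R u"
  show "loc_integrable (\<lambda>y. u (hyp_param R y))"
    unfolding loc_integrable_def
  proof
    fix r
    have [measurable]: "cball (0 :: real ^ 'n) r \<in> sets borel" by simp
    let ?K = "hyp_param R ` cball 0 r"
    have ind: "indicator ?K (hyp_param R y) = (indicator (cball 0 r) y :: real)" for y
      by (auto simp: indicator_def)
    have "set_integrable (hyp_vol R) ?K u"
      using * unfolding locally_integrable_def by (simp add: compact_chart)
    then have "integrable lborel (\<lambda>y. dens y * (indicator (cball 0 r) y * u (hyp_param R y)))"
      unfolding set_integrable_def by (subst (asm) integrable_hyp_vol) (simp_all add: ind)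
    \<comment> \<open>The factor compensates for \<open>dens\<close>, which is at least R / (R +
      |r|) on this ball.\<close>
    then have "integrable lborel (\<lambda>y. (R + \<bar>r\<bar>) / R * (dens y * (indicator (cball 0 r) y * u (hyp_param R y))))"
      by (intro integrable_mult_right)
    then show "integrable lborel (\<lambda>y. indicator (cball 0 r) y * u (hyp_param R y))"
    proof (rule Bochner_Integration.integrable_bound)
      show "AE y in lborel. norm (indicator (cball 0 r) y * u (hyp_param R y))
        \<le> norm ((R + \<bar>r\<bar>) / R * (dens y * (indicator (cball 0 r) y * u (hyp_param R y))))"
      proof (rule AE_I2)
        fix y :: "real ^ 'n"
        show "norm (indicator (cball 0 r) y * u (hyp_param R y))
          \<le> norm ((R + \<bar>r\<bar>) / R * (dens y * (indicator (cball 0 r) y * u (hyp_param R y))))"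
        proof (cases "y \<in> cball 0 r")
          case True
          then have "height y \<le> R + \<bar>r\<bar>" using height_le[of y] by simp
          then have "1 \<le> (R + \<bar>r\<bar>) / R * dens y"
            using height_pos[of y] R_pos by (simp add: dens_def)
          from mult_right_mono[OF this, of "\<bar>u (hyp_param R y)\<bar>"] show ?thesis
            using True R_pos dens_pos[of y] by (simp add: abs_mult)
        qed simp
      qed
      show "(\<lambda>y. indicator (cball 0 r) y * u (hyp_param R y)) \<in> borel_measurable lborel" by measurable
    qed
  qed
next
  note [measurable] = u dens_measurable
  assume *: "loc_integrable (\<lambda>y. u (hyp_param R y))"
  show "locally_integrable R u"
    unfolding locally_integrable_def
  proof (intro allI impI)
    fix K :: "(real \<times> (real ^ 'n)) set" assume K: "compact K \<and> K \<subseteq> hyperboloid R"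
    obtain r where r: "\<And>y. hyp_param R y \<in> K \<Longrightarrow> norm y \<le> r"
      using K compact_hyperboloid_bounded by blast
    have Kc: "closed K" using K compact_imp_closed by blast
    have "hyp_param R \<in> borel_measurable borel"
      by (intro borel_measurable_continuous_onI continuous_on_hyp_param)
    then have [measurable]: "(\<lambda>y. indicator K (hyp_param R y) :: real) \<in> borel_measurable borel"
      by (rule measurable_compose) (use Kc in simp)
    have "integrable lborel (\<lambda>y. indicator (cball 0 r) y * u (hyp_param R y))"
      using * by (simp add: loc_integrable_def)
    then have "integrable lborel (\<lambda>y. dens y * (indicator K (hyp_param R y) * u (hyp_param R y)))"
    proof (rule Bochner_Integration.integrable_bound)
      show "AE y in lborel. norm (dens y * (indicator K (hyp_param R y) * u (hyp_param R y)))
        \<le> norm (indicator (cball 0 r) y * u (hyp_param R y))"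
      proof (rule AE_I2)
        fix y
        show "norm (dens y * (indicator K (hyp_param R y) * u (hyp_param R y)))
          \<le> norm (indicator (cball 0 r) y * u (hyp_param R y))"
          using r[of y] dens_le_1[of y] dens_pos[of y]
            mult_right_mono[of "dens y" 1 "\<bar>u (hyp_param R y)\<bar>"]
          by (cases "hyp_param R y \<in> K") (auto simp: abs_mult)
      qed
      show "(\<lambda>y. dens y * (indicator K (hyp_param R y) * u (hyp_param R y))) \<in> borel_measurable lborel"
        by measurable
    qed
    then show "set_integrable (hyp_vol R) K u"
      unfolding set_integrable_def by (subst integrable_hyp_vol) simp_all
  qed
qed

lemma test_function_iff:
  "test_function R \<phi> \<longleftrightarrow> smooth_on (\<lambda>y. \<phi> (hyp_param R y)) UNIV \<and> compactly_supported (\<lambda>y. \<phi> (hyp_param R y))"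
proof
  assume *: "test_function R \<phi>"
  then obtain K where K: "compact K" "\<And>x. x \<in> hyperboloid R - K \<Longrightarrow> \<phi> x = 0"
    by (auto simp: test_function_def)
  obtain r where "\<And>y. hyp_param R y \<in> K \<Longrightarrow> norm y \<le> r"
    using K compact_hyperboloid_bounded by blast
  then have "\<phi> (hyp_param R y) = 0" if "norm y > r" for y
    using that hyp_param_mem[of y] by (intro K(2)) force
  then show "smooth_on (\<lambda>y. \<phi> (hyp_param R y)) UNIV \<and> compactly_supported (\<lambda>y. \<phi> (hyp_param R y))"
    using * by (auto simp: test_function_def smooth_on_hyperboloid_def compactly_supported_def)
next
  assume *: "smooth_on (\<lambda>y. \<phi> (hyp_param R y)) UNIV \<and> compactly_supported (\<lambda>y. \<phi> (hyp_param R y))"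
  then obtain r where r: "\<And>y. norm y > r \<Longrightarrow> \<phi> (hyp_param R y) = 0"
    by (auto simp: compactly_supported_def)
  have "\<phi> x = 0" if "x \<in> hyperboloid R - hyp_param R ` cball 0 r" for x
  proof -
    have x: "x = hyp_param R (snd x)" using that hyperboloidD by blast
    then have "snd x \<notin> cball 0 r" using that by blast
    then show ?thesis using r[of "snd x"] x by simp
  qed
  then show "test_function R \<phi>"
    unfolding test_function_def smooth_on_hyperboloid_def
    using * compact_chart(1)[of r] compact_chart(2)[of "cball 0 r"] by blast
qed

text \<open>The density in the volume measure cancels the factor 1 / dens of the Laplace-Beltrami
  operator. In the other direction a chart function extends to a test function by composition with
  \<open>snd\<close>.\<close>

lemma neg_laplacian_eq_dirac_iff:
  fixes u :: "real \<times> (real ^ 'n) \<Rightarrow> real"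
  assumes u: "(\<lambda>y. u (hyp_param R y)) \<in> borel_measurable borel"
  shows "neg_laplacian_eq_dirac R u (hyp_param R b) \<longleftrightarrow>
    (\<forall>\<phi>. smooth_on \<phi> UNIV \<longrightarrow> compactly_supported \<phi> \<longrightarrow>
      (\<integral>y. u (hyp_param R y) * - lapl \<phi> y \<partial>lborel) = \<phi> b)"
proof -
  note [measurable] = u dens_measurable
  have eq: "(\<integral>x. u x * (- laplace_beltrami R \<phi> x) \<partial>hyp_vol R)
      = (\<integral>y. u (hyp_param R y) * - lapl (\<lambda>y. \<phi> (hyp_param R y)) y \<partial>lborel)"
    if "smooth_on (\<lambda>y. \<phi> (hyp_param R y)) UNIV" for \<phi>
  proof -
    have [measurable]: "lapl (\<lambda>y. \<phi> (hyp_param R y)) \<in> borel_measurable borel"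
      using that by (intro borel_measurable_continuous_onI smooth_on_imp_continuous_on smooth_on_lapl)
    have nz: "dens y \<noteq> 0" for y using dens_pos[of y] by simp
    show ?thesis
      by (subst integral_hyp_vol) (simp_all add: laplace_beltrami_hyp_param nz)
  qed
  show ?thesis
  proof
    assume *: "neg_laplacian_eq_dirac R u (hyp_param R b)"
    show "\<forall>\<phi>. smooth_on \<phi> UNIV \<longrightarrow> compactly_supported \<phi> \<longrightarrow>
      (\<integral>y. u (hyp_param R y) * - lapl \<phi> y \<partial>lborel) = \<phi> b"
    proof (intro allI impI)
      fix \<phi> :: "real ^ 'n \<Rightarrow> real" assume \<phi>: "smooth_on \<phi> UNIV" "compactly_supported \<phi>"
      have "test_function R (\<lambda>x. \<phi> (snd x))" using \<phi> by (simp add: test_function_iff)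
      then have "(\<integral>x. u x * (- laplace_beltrami R (\<lambda>x. \<phi> (snd x)) x) \<partial>hyp_vol R) = \<phi> b"
        using * by (auto simp: neg_laplacian_eq_dirac_def)
      then show "(\<integral>y. u (hyp_param R y) * - lapl \<phi> y \<partial>lborel) = \<phi> b"
        using eq[of "\<lambda>x. \<phi> (snd x)"] \<phi> by simp
    qed
  next
    assume *: "\<forall>\<phi>. smooth_on \<phi> UNIV \<longrightarrow> compactly_supported \<phi> \<longrightarrow>
      (\<integral>y. u (hyp_param R y) * - lapl \<phi> y \<partial>lborel) = \<phi> b"
    show "neg_laplacian_eq_dirac R u (hyp_param R b)"
      unfolding neg_laplacian_eq_dirac_def test_function_iff
    proof (intro allI impI)
      fix \<phi> :: "real \<times> (real ^ 'n) \<Rightarrow> real"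
      assume \<phi>: "smooth_on (\<lambda>y. \<phi> (hyp_param R y)) UNIV \<and> compactly_supported (\<lambda>y. \<phi> (hyp_param R y))"
      then show "(\<integral>x. u x * (- laplace_beltrami R \<phi> x) \<partial>hyp_vol R) = \<phi> (hyp_param R b)"
        unfolding eq[OF conjunct1[OF \<phi>]] using * by blast
    qed
  qed
qed

text \<open>The distance is R arcosh of \<open>coshd\<close>, so \<open>coshd_lower\<close> and
  \<open>coshd_upper\<close> convert large distance into large norm and back.\<close>

lemma vanishes_at_infinity_iff:
  "vanishes_at_infinity R u (hyp_param R b) \<longleftrightarrow>
    (\<forall>\<epsilon>>0. \<exists>r. \<forall>y. norm y > r \<longrightarrow> \<bar>u (hyp_param R y)\<bar> < \<epsilon>)"
proof -
  have dist: "geodesic_dist R (hyp_param R y) (hyp_param R b) = R * arcosh (coshd b y)" for y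
    by (simp add: geodesic_dist_def hyp_param_minkowski coshd_commute)
  have far: "\<exists>r. \<forall>y. norm y > r \<longrightarrow> geodesic_dist R (hyp_param R y) (hyp_param R b) > M" if M: "M > 0" for M
  proof -
    have "R * arcosh (coshd b y) > M" if "norm y > 2 * height b * cosh (M / R)" for y
    proof -
      have "2 * height b * cosh (M / R) < 2 * height b * coshd b y"
        using that height_ge(2)[of y] coshd_lower[of y b] by linarith
      then have "cosh (M / R) < coshd b y" using height_pos[of b] by simp
      then have "arcosh (cosh (M / R)) < arcosh (coshd b y)"
        by (intro arcosh_real_strict_mono) (auto simp: cosh_real_ge_1)
      then show ?thesis using M R_pos by (simp add: arcosh_cosh_real field_simps)
    qed
    then show ?thesis using dist by metis
  qed
  have near: "\<exists>M>0. \<forall>y. geodesic_dist R (hyp_param R y) (hyp_param R b) > M \<longrightarrow> norm y > r" for r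
  proof -
    define T where "T = max 1 (2 * height b * (R + \<bar>r\<bar>) / R\<^sup>2)"
    have "R * arcosh (coshd b y) \<le> R * arcosh T" if "norm y \<le> r" for y
    proof -
      have "height y \<le> R + \<bar>r\<bar>" using height_le[of y] that by linarith
      then have "R\<^sup>2 * coshd b y \<le> 2 * height b * (R + \<bar>r\<bar>)"
        using coshd_upper[of b y] mult_left_mono[of "height y" "R + \<bar>r\<bar>" "height b"] height_pos[of b]
        by linarith
      then have "coshd b y \<le> 2 * height b * (R + \<bar>r\<bar>) / R\<^sup>2"
        using R_pos by (simp add: pos_le_divide_eq mult.commute)
      then have "coshd b y \<le> T" by (simp add: T_def)
      then have "arcosh (coshd b y) \<le> arcosh T"
        using coshd_ge_1[of b y]
        by (cases "coshd b y = T") (auto intro!: less_imp_le[OF arcosh_real_strict_mono])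
      then show ?thesis using R_pos by simp
    qed
    \<comment> \<open>\<open>arcosh T\<close> may be 0; the summand 1 provides the positive M that
      the definition asks for.\<close>
    then have "norm y > r" if "R * arcosh (coshd b y) > R * arcosh T + 1" for y
      using that by (smt (verit))
    moreover have "R * arcosh T + 1 > 0"
      using R_pos arcosh_nonneg_real[of T] by (intro add_nonneg_pos mult_nonneg_nonneg) (auto simp: T_def)
    ultimately show ?thesis using dist by metis
  qed
  show ?thesis unfolding vanishes_at_infinity_def
  proof (intro iffI allI impI)
    fix \<epsilon> :: real assume "\<epsilon> > 0"
      and *: "\<forall>\<epsilon>>0. \<exists>M>0. \<forall>x\<in>hyperboloid R. geodesic_dist R x (hyp_param R b) > M \<longrightarrow> \<bar>u x\<bar> < \<epsilon>"
    then obtain M where "M > 0"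
      "\<And>x. x \<in> hyperboloid R \<Longrightarrow> geodesic_dist R x (hyp_param R b) > M \<Longrightarrow> \<bar>u x\<bar> < \<epsilon>" by blast
    then show "\<exists>r. \<forall>y. norm y > r \<longrightarrow> \<bar>u (hyp_param R y)\<bar> < \<epsilon>"
      using far[of M] hyp_param_mem by meson
  next
    fix \<epsilon> :: real assume "\<epsilon> > 0"
      and *: "\<forall>\<epsilon>>0. \<exists>r. \<forall>y. norm y > r \<longrightarrow> \<bar>u (hyp_param R y)\<bar> < \<epsilon>"
    then obtain r where r: "\<And>y. norm y > r \<Longrightarrow> \<bar>u (hyp_param R y)\<bar> < \<epsilon>" by blast
    obtain M where M: "M > 0"
      "\<And>y. geodesic_dist R (hyp_param R y) (hyp_param R b) > M \<Longrightarrow> norm y > r" using near[of r] by blast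
    have "\<bar>u x\<bar> < \<epsilon>" if "x \<in> hyperboloid R" "geodesic_dist R x (hyp_param R b) > M" for x
      using hyperboloidD[OF that(1)] M(2)[of "snd x"] r[of "snd x"] that(2) by metis
    then show "\<exists>M>0. \<forall>x\<in>hyperboloid R. geodesic_dist R x (hyp_param R b) > M \<longrightarrow> \<bar>u x\<bar> < \<epsilon>"
      using M(1) by blast
  qed
qed

end

context hyperbolic_green
begin

section \<open>The normalised Green function on the hyperboloid\<close>

lemma open_neq_pairs: "open {(y, y'). y \<noteq> (y' :: real ^ 'n)}"
  using open_Collect_neq[OF continuous_on_fst[OF continuous_on_id] continuous_on_snd[OF continuous_on_id]]
  by (simp add: case_prod_unfold)

lemma smooth_on_G_pair: "smooth_on (\<lambda>(y, y'). G y y') {(y, y'). y \<noteq> y'}"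
proof -
  let ?D = "{(y, y'). y \<noteq> y'} :: ((real ^ 'n) \<times> (real ^ 'n)) set"
  note D = open_neq_pairs
  have "smooth_on (\<lambda>z::(real ^ 'n) \<times> (real ^ 'n). (height (fst z) * height (snd z)
      - (\<Sum>i\<in>UNIV. fst z $ i * snd z $ i)) * (1 / R\<^sup>2)) UNIV"
    by (intro smooth_on_mult smooth_on_diff smooth_on_sum smooth_on_const smooth_on_height_linear
        bounded_linear_fst bounded_linear_snd
        smooth_on_linear[OF _ bounded_linear_compose[OF bounded_linear_vec_nth bounded_linear_fst]]
        smooth_on_linear[OF _ bounded_linear_compose[OF bounded_linear_vec_nth bounded_linear_snd]]) auto
  then have "smooth_on (\<lambda>z::(real ^ 'n) \<times> (real ^ 'n). coshd (fst z) (snd z)) UNIV"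
    by (rule smooth_on_cong[OF open_UNIV, rotated]) (simp add: coshd_def inner_vec_def)
  then have "smooth_on (\<lambda>z. coshd (fst z) (snd z)) ?D"
    by (rule smooth_on_subset) simp
  then have "smooth_on (\<lambda>z. profile CARD('n) (coshd (fst z) (snd z))) ?D"
    by (rule smooth_on_compose[where g = "profile CARD('n)", OF D _ smooth_on_profile[OF dim_ge_2]])
      (auto intro!: coshd_gt_1)
  then show ?thesis
    by (simp add: G_def case_prod_unfold)
qed

text \<open>By \<open>mass_const\<close> the base point 0 stands for every pole, and a constant
  divisor keeps joint smoothness evident. \<open>restrict\<close> assigns the default value off the
  domain, so that uniqueness can be equality of functions.\<close>

definition green_function :: "(real \<times> (real ^ 'n)) \<times> (real \<times> (real ^ 'n)) \<Rightarrow> real" where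
  "green_function = restrict (\<lambda>(x, x'). G (snd x) (snd x') / mass 0) (off_diagonal R)"

lemma off_diagonal_iff:
  fixes y y' :: "real ^ 'n"
  shows "(hyp_param R y, hyp_param R y') \<in> off_diagonal R \<longleftrightarrow> y \<noteq> y'"
proof -
  have "(off_diagonal R :: ((real \<times> (real ^ 'n)) \<times> (real \<times> (real ^ 'n))) set)
      = {z \<in> hyperboloid R \<times> hyperboloid R. fst z \<noteq> snd z}"
    by (auto simp: off_diagonal_def)
  then show ?thesis by (simp add: hyp_param_mem)
qed

lemma green_function_eq: "y \<noteq> y' \<Longrightarrow> green_function (hyp_param R y, hyp_param R y') = G y y' / mass 0"
  by (simp add: green_function_def off_diagonal_iff)

lemma smooth_on_off_diagonal_green_function: "smooth_on_off_diagonal R green_function"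
proof -
  note D = open_neq_pairs
  have "smooth_on (\<lambda>z. (case z of (y, y') \<Rightarrow> G y y') * (1 / mass 0)) {(y, y'). y \<noteq> y'}"
    by (intro smooth_on_mult[OF D] smooth_on_G_pair smooth_on_const)
  then show ?thesis unfolding smooth_on_off_diagonal_def
    by (rule smooth_on_cong[OF D, rotated]) (auto simp: green_function_eq)
qed

text \<open>The arbitrary value on the diagonal affects a single point of each section, and
  countably many exceptions to continuity leave measurability intact.\<close>

lemma measurable_off_pole:
  fixes H :: "(real \<times> (real ^ 'n)) \<times> (real \<times> (real ^ 'n)) \<Rightarrow> real"
  assumes "smooth_on_off_diagonal R H"
  shows "continuous_on (- {b}) (\<lambda>y. H (hyp_param R y, hyp_param R b))"
    and "(\<lambda>y. H (hyp_param R y, hyp_param R b)) \<in> borel_measurable borel"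
proof -
  have "continuous_on {(y, y'). y \<noteq> y'} (\<lambda>(y, y'). H (hyp_param R y, hyp_param R y'))"
    using assms unfolding smooth_on_off_diagonal_def by (rule smooth_on_imp_continuous_on)
  then have "continuous_on (- {b}) (\<lambda>y. (\<lambda>(y, y'). H (hyp_param R y, hyp_param R y')) (y, b))"
    by (rule continuous_on_compose2) (auto intro!: continuous_intros)
  then show c: "continuous_on (- {b}) (\<lambda>y. H (hyp_param R y, hyp_param R b))" by simp
  show "(\<lambda>y. H (hyp_param R y, hyp_param R b)) \<in> borel_measurable borel"
    by (rule borel_measurable_continuous_countable_exceptions[of "{b}"]) (auto simp: c)
qed

lemma green_function_AE: "AE y in lborel. green_function (hyp_param R y, hyp_param R b) = G b y / mass b"
  using AE_lborel_singleton[of b] by eventually_elim (simp add: green_function_eq G_commute mass_const[of 0 b])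

lemma green_function_solves:
  "locally_integrable R (\<lambda>x. green_function (x, hyp_param R b))"
  "neg_laplacian_eq_dirac R (\<lambda>x. green_function (x, hyp_param R b)) (hyp_param R b)"
  "vanishes_at_infinity R (\<lambda>x. green_function (x, hyp_param R b)) (hyp_param R b)"
proof -
  have m: "(\<lambda>y. green_function (hyp_param R y, hyp_param R b)) \<in> borel_measurable borel"
    by (rule measurable_off_pole[OF smooth_on_off_diagonal_green_function])
  note [measurable] = m G_measurable
  have "loc_integrable (\<lambda>y. green_function (hyp_param R y, hyp_param R b))"
    unfolding loc_integrable_def
  proof
    fix r
    have [measurable]: "cball (0 :: real ^ 'n) r \<in> sets borel" by simp
    have "integrable lborel (\<lambda>y. indicator (cball 0 r) y * G b y / mass b)"
      using loc_integrable_G[of b] by (simp add: loc_integrable_def)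
    moreover have "AE y in lborel. indicator (cball 0 r) y * G b y / mass b
        = indicator (cball 0 r) y * green_function (hyp_param R y, hyp_param R b)"
      using green_function_AE[of b] by eventually_elim simp
    ultimately show "integrable lborel (\<lambda>y. indicator (cball 0 r) y * green_function (hyp_param R y, hyp_param R b))"
      by (subst (asm) integrable_cong_AE[rotated 2]) (assumption, measurable)
  qed
  then show "locally_integrable R (\<lambda>x. green_function (x, hyp_param R b))"
    using locally_integrable_iff[OF m] by simp
  have "(\<integral>y. green_function (hyp_param R y, hyp_param R b) * - lapl \<phi> y \<partial>lborel) = \<phi> b"
    if \<phi>: "smooth_on \<phi> UNIV" "compactly_supported \<phi>" for \<phi>
  proof -
    have [measurable]: "lapl \<phi> \<in> borel_measurable borel"
      using \<phi> by (intro borel_measurable_continuous_onI smooth_on_imp_continuous_on smooth_on_lapl)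
    have "(\<integral>y. green_function (hyp_param R y, hyp_param R b) * - lapl \<phi> y \<partial>lborel)
      = (\<integral>y. (G b y * - lapl \<phi> y) / mass b \<partial>lborel)"
    proof (rule integral_cong_AE)
      show "AE y in lborel. green_function (hyp_param R y, hyp_param R b) * - lapl \<phi> y = (G b y * - lapl \<phi> y) / mass b"
        using green_function_AE[of b] by eventually_elim simp
    qed measurable
    also have "\<dots> = (\<integral>y. G b y * - lapl \<phi> y \<partial>lborel) / mass b"
      by (rule integral_divide_zero)
    also have "\<dots> = \<phi> b"
      unfolding integral_G_lapl[OF \<phi>] using mass_pos[of b] by simp
    finally show ?thesis .
  qed
  then show "neg_laplacian_eq_dirac R (\<lambda>x. green_function (x, hyp_param R b)) (hyp_param R b)"
    unfolding neg_laplacian_eq_dirac_iff[OF m] by blast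
  show "vanishes_at_infinity R (\<lambda>x. green_function (x, hyp_param R b)) (hyp_param R b)"
    unfolding vanishes_at_infinity_iff
  proof (intro allI impI)
    fix \<epsilon> :: real assume "\<epsilon> > 0"
    then have "\<epsilon> * mass b > 0" using mass_pos[of b] by simp
    from G_decay[OF this, of b] obtain r where r: "\<And>y. norm y > r \<Longrightarrow> \<bar>G b y\<bar> < \<epsilon> * mass b" by blast
    have "\<bar>green_function (hyp_param R y, hyp_param R b)\<bar> < \<epsilon>" if "norm y > max r (norm b)" for y
    proof -
      have "y \<noteq> b" using that by auto
      then show ?thesis
        using r[of y] that mass_pos[of b] by (simp add: green_function_eq G_commute[of y b] mass_const[of 0 b] field_simps)
    qed
    then show "\<exists>r. \<forall>y. norm y > r \<longrightarrow> \<bar>green_function (hyp_param R y, hyp_param R b)\<bar> < \<epsilon>" by blast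
  qed
qed

lemma green_function_unique:
  fixes H :: "(real \<times> (real ^ 'n)) \<times> (real \<times> (real ^ 'n)) \<Rightarrow> real"
  assumes ext: "H \<in> extensional (off_diagonal R)" and sm: "smooth_on_off_diagonal R H"
    and sol: "\<And>x'. x' \<in> hyperboloid R \<Longrightarrow> locally_integrable R (\<lambda>x. H (x, x')) \<and>
      neg_laplacian_eq_dirac R (\<lambda>x. H (x, x')) x' \<and> vanishes_at_infinity R (\<lambda>x. H (x, x')) x'"
  shows "H = green_function"
proof (rule extensionalityI[OF ext])
  show "green_function \<in> extensional (off_diagonal R)" by (simp add: green_function_def)
  fix z :: "(real \<times> (real ^ 'n)) \<times> (real \<times> (real ^ 'n))"
  assume z: "z \<in> off_diagonal R"
  define a b where "a = snd (fst z)" and "b = snd (snd z)"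
  have z_eq: "z = (hyp_param R a, hyp_param R b)"
    using z hyperboloidD[of "fst z"] hyperboloidD[of "snd z"]
    by (auto simp: off_diagonal_def a_def b_def prod_eq_iff)
  have ab: "a \<noteq> b" using z off_diagonal_iff[of a b] by (simp add: z_eq)
  define v where "v y = H (hyp_param R y, hyp_param R b)" for y
  note m = measurable_off_pole[OF sm, of b]
  note s = sol[OF hyp_param_mem[of b]]
  \<comment> \<open>The unknown has its singularity at b and is continuous at a by smoothness off
    the diagonal, so the reciprocity law with c = 1 determines its value at a.\<close>
  have "mass a * v a = 1 * G a b"
  proof (rule solution_value)
    show "loc_integrable v"
      using s locally_integrable_iff[OF m(2)] by (simp add: v_def[abs_def])
    show "(\<integral>y. v y * - lapl \<phi> y \<partial>lborel) = 1 * \<phi> b"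
      if "smooth_on \<phi> UNIV" "compactly_supported \<phi>" for \<phi>
      using s that neg_laplacian_eq_dirac_iff[OF m(2)] by (simp add: v_def)
    show "isCont v a"
      using m(1) ab unfolding v_def[abs_def] by (subst (asm) continuous_on_eq_continuous_at) auto
    show "a \<noteq> b" by (rule ab)
    show "\<exists>r. \<forall>y. norm y > r \<longrightarrow> \<bar>v y\<bar> < \<epsilon>" if "\<epsilon> > 0" for \<epsilon>
      using s that unfolding vanishes_at_infinity_iff v_def by blast
  qed
  then show "H z = green_function z"
    using mass_pos[of a] ab by (simp add: z_eq v_def green_function_eq mass_const[of 0 a] field_simps)
qed

end

theorem proposition4p1:
  fixes R :: real
  assumes "CARD('n::finite) \<ge> 2" and "R > 0"
  shows "\<exists>!H :: (real \<times> (real ^ 'n)) \<times> (real \<times> (real ^ 'n)) \<Rightarrow> real.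
           H \<in> extensional (off_diagonal R) \<and>
           smooth_on_off_diagonal R H \<and>
           (\<forall>x'\<in>hyperboloid R.
              locally_integrable R (\<lambda>x. H (x, x')) \<and>
              neg_laplacian_eq_dirac R (\<lambda>x. H (x, x')) x' \<and>
              vanishes_at_infinity R (\<lambda>x. H (x, x')) x')"
proof -
  interpret hyperbolic_green R "TYPE('n)"
    by unfold_locales (use assms in auto)
  show ?thesis
  proof (rule ex1I[of _ green_function], intro conjI ballI)
    show "green_function \<in> extensional (off_diagonal R)" by (simp add: green_function_def)
    show "smooth_on_off_diagonal R green_function" by (rule smooth_on_off_diagonal_green_function)
    fix x' :: "real \<times> (real ^ 'n)"
    assume "x' \<in> hyperboloid R"
    then have x': "x' = hyp_param R (snd x')" by (rule hyperboloidD)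
    show "locally_integrable R (\<lambda>x. green_function (x, x'))" by (subst x') (rule green_function_solves)
    show "neg_laplacian_eq_dirac R (\<lambda>x. green_function (x, x')) x'"
      using green_function_solves(2)[of "snd x'"] by (simp flip: x')
    show "vanishes_at_infinity R (\<lambda>x. green_function (x, x')) x'"
      using green_function_solves(3)[of "snd x'"] by (simp flip: x')
  next
    fix H :: "(real \<times> (real ^ 'n)) \<times> (real \<times> (real ^ 'n)) \<Rightarrow> real"
    assume "H \<in> extensional (off_diagonal R) \<and> smooth_on_off_diagonal R H \<and>
      (\<forall>x'\<in>hyperboloid R. locally_integrable R (\<lambda>x. H (x, x')) \<and>
        neg_laplacian_eq_dirac R (\<lambda>x. H (x, x')) x' \<and>
        vanishes_at_infinity R (\<lambda>x. H (x, x')) x')"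
    then show "H = green_function" by (intro green_function_unique) auto
  qed
qed

end
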